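(* Let $f,g\in\mathbb{C}(z)$ be rational functions and $x_0,y_0\in\mathbb{P}^1$. If the orbit $\{(f^n(x_0),g^n(y_0)):n\ge0\}$ of $(x_0,y_0)$ under $f\times g$ contains infinitely many points of the diagonal of $\mathbb{P}^1\times\mathbb{P}^1$, then $\deg f=\deg g$.
   Context: $f^n$ denotes the $n$-fold iterate; rational functions act on the Riemann sphere $\mathbb{P}^1$. *)

theory Defs
  imports
    Complex_Main
    "HOL-Computational_Algebra.Computational_Algebra"
    "HOL-Computational_Algebra.Field_as_Ring"
begin

text \<open>The Riemann sphere, as the complex plane with one point added.\<close>

datatype P1 = Finite complex | Infinity

text \<open>
  The field of rational functions over the complex numbers is \<^typ>\<open>complex poly fract\<close>, and
  \<^const>\<open>quot_of_fract\<close> returns numerator and denominator in lowest terms.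
\<close>

definition ratfun_degree :: "complex poly fract \<Rightarrow> nat" where
  "ratfun_degree f = (case quot_of_fract f of (p, q) \<Rightarrow> max (degree p) (degree q))"

text \<open>
  If \<open>P\<close>, \<open>Q\<close> are the homogenizations of \<open>p\<close>, \<open>q\<close> to the common degree \<open>d = ratfun_degree f\<close>, the
  map on the projective line is \<open>[z : w] \<mapsto> [P(z, w) : Q(z, w)]\<close>; at infinity, i.e. at
  \<open>[1 : 0]\<close>, these take the values \<open>coeff p d\<close> and \<open>coeff q d\<close>, which are not both zero
  (if \<open>d = 0\<close>, then \<open>q\<close> is a nonzero constant).
\<close>

definition P1_quot :: "complex \<Rightarrow> complex \<Rightarrow> P1" where
  "P1_quot a b = (if b = 0 then Infinity else Finite (a / b))"

definition ratfun_map :: "complex poly fract \<Rightarrow> P1 \<Rightarrow> P1" where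
  "ratfun_map f x =
     (case quot_of_fract f of (p, q) \<Rightarrow>
       (case x of
          Finite z \<Rightarrow> P1_quot (poly p z) (poly q z)
        | Infinity \<Rightarrow> P1_quot (coeff p (ratfun_degree f)) (coeff q (ratfun_degree f))))"

end

theory Submission
  imports Defs
begin

text \<open>
  Suppose \<open>deg f = d > e = deg g\<close>. All data lie in the fraction field of a finitely generated domain
  \<open>R\<close>, which is given a submultiplicative size. Let the height of a point \<open>[a : b]\<close> be the growth rate
  in \<open>n\<close> of the smallest common size of \<open>\<nu> a ^ i b ^ (n - i)\<close>, \<open>i \<le> n\<close>, over all scalars \<open>\<nu>\<close> that make
  these elements of \<open>R\<close>. In logarithmic scale \<open>f\<close> multiplies heights by \<open>d\<close> up to a bounded error, and
  the height of \<open>g ^ n y\<^sub>0\<close> is at most of the order of \<open>n e ^ n\<close>. Pulling the coincidences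
  \<open>f ^ n x\<^sub>0 = g ^ n y\<^sub>0\<close> back along \<open>f\<close> therefore bounds the heights of all points of the orbit of
  \<open>x\<^sub>0\<close> by one constant.

  Northcott's theorem is replaced by congruences: \<open>R\<close> has an ideal \<open>I\<close> of finite index, adapted to
  that constant, such that small elements of \<open>I ^ n\<close> vanish for large \<open>n\<close>. Two points of the orbit are
  congruent modulo \<open>I\<close>, and \<open>\<nu> \<nu>' (a b' - a' b) ^ n\<close> is a small element of \<open>I ^ n\<close>, so these two points
  coincide and the orbit of \<open>x\<^sub>0\<close> is finite.
\<close>

section \<open>Subrings, ideals and sizes\<close>

text \<open>Submultiplicativity gives no lower bounds for sizes, and orbit coordinates may have
  large common factors; hence the scalars \<nu> are not confined to \<open>R\<close>, and only
  growth rates count. The rate is uniform along the orbit: pulling back k steps costs a geometric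
  series of factors, at most \<open>C\<close> per unit of degree, and as the coincidence may be
  chosen after the orbit point, g contributes at most 2 per unit of degree. This is the constant
  \<open>S = 2 * C\<close>. The price is that \<nu> \<nu>' (a b' - a' b) ^ n is not visibly in I ^
  n, since \<nu> and \<nu>' may have denominators. If u is an \<open>R\<close>-combination of a and
  b with u = 1 modulo I, then \<nu> u ^ n lies in \<open>R\<close>, and u ^ n can be cancelled
  afterwards. So all orbit points must stay unimodular modulo I. This is why the ideals are required
  to make a prescribed nonzero \<rho> invertible; it is applied to a Bezout constant of f times a
  coordinate of the starting point.\<close>

locale subring =
  fixes R :: "'a :: idom set"
  assumes one_mem: "1 \<in> R"
    and diff_mem: "\<And>x y. x \<in> R \<Longrightarrow> y \<in> R \<Longrightarrow> x - y \<in> R"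
    and mult_mem: "\<And>x y. x \<in> R \<Longrightarrow> y \<in> R \<Longrightarrow> x * y \<in> R"
begin

lemma zero_mem: "0 \<in> R"
  using diff_mem[OF one_mem one_mem] by simp

lemma uminus_mem: "x \<in> R \<Longrightarrow> - x \<in> R"
  using diff_mem[OF zero_mem] by simp

lemma add_mem: "x \<in> R \<Longrightarrow> y \<in> R \<Longrightarrow> x + y \<in> R"
  using diff_mem[OF _ uminus_mem] by force

lemma power_mem: "x \<in> R \<Longrightarrow> x ^ n \<in> R"
  by (induction n) (auto intro: one_mem mult_mem)

lemma of_nat_mem: "of_nat n \<in> R"
  by (induction n) (auto intro: one_mem zero_mem add_mem)

lemma sum_mem: "(\<And>i. i \<in> A \<Longrightarrow> f i \<in> R) \<Longrightarrow> sum f A \<in> R"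
  by (induction A rule: infinite_finite_induct) (auto intro: zero_mem add_mem)

lemma prod_mem: "(\<And>i. i \<in> A \<Longrightarrow> f i \<in> R) \<Longrightarrow> prod f A \<in> R"
  by (induction A rule: infinite_finite_induct) (auto intro: one_mem mult_mem)

lemmas mems = zero_mem one_mem uminus_mem add_mem diff_mem mult_mem power_mem of_nat_mem

end

locale subring_ideal = subring R for R :: "'a :: idom set" +
  fixes I :: "'a set"
  assumes ideal_zero: "0 \<in> I"
    and ideal_sub: "x \<in> I \<Longrightarrow> x \<in> R"
    and ideal_add: "x \<in> I \<Longrightarrow> y \<in> I \<Longrightarrow> x + y \<in> I"
    and ideal_mult: "r \<in> R \<Longrightarrow> x \<in> I \<Longrightarrow> r * x \<in> I"
begin

lemma ideal_uminus: "x \<in> I \<Longrightarrow> - x \<in> I"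
  using ideal_mult[OF uminus_mem[OF one_mem]] by simp

lemma ideal_diff: "x \<in> I \<Longrightarrow> y \<in> I \<Longrightarrow> x - y \<in> I"
  using ideal_add[OF _ ideal_uminus] by force

lemma ideal_sum: "(\<And>i. i \<in> A \<Longrightarrow> f i \<in> I) \<Longrightarrow> sum f A \<in> I"
  by (induction A rule: infinite_finite_induct) (auto intro: ideal_zero ideal_add)

lemma ideal_mult_right: "x \<in> I \<Longrightarrow> r \<in> R \<Longrightarrow> x * r \<in> I"
  using ideal_mult by (metis mult.commute)

end

lemma (in subring) subring_ideal_self: "subring_ideal R R"
  by unfold_locales (auto intro: mems)

section \<open>Products and powers of ideals\<close>

inductive_set ideal_product :: "'a :: idom set \<Rightarrow> 'a set \<Rightarrow> 'a set" for I J
  where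
    mult: "x \<in> I \<Longrightarrow> y \<in> J \<Longrightarrow> x * y \<in> ideal_product I J"
  | add: "x \<in> ideal_product I J \<Longrightarrow> y \<in> ideal_product I J \<Longrightarrow> x + y \<in> ideal_product I J"

primrec ideal_power :: "'a :: idom set \<Rightarrow> 'a set \<Rightarrow> nat \<Rightarrow> 'a set" where
  "ideal_power R I 0 = R"
| "ideal_power R I (Suc n) = ideal_product I (ideal_power R I n)"

lemma subring_ideal_product:
  assumes "subring_ideal R I" "subring_ideal R J"
  shows "subring_ideal R (ideal_product I J)"
proof -
  interpret I: subring_ideal R I by fact
  interpret J: subring_ideal R J by fact
  show ?thesis
  proof
    show "0 \<in> ideal_product I J"
      using ideal_product.mult[OF I.ideal_zero J.ideal_zero] by simp
    show "x \<in> R" if "x \<in> ideal_product I J" for x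
      using that by induction (auto intro: I.mems I.ideal_sub J.ideal_sub)
    show "r * x \<in> ideal_product I J" if "r \<in> R" "x \<in> ideal_product I J" for r x
      using that(2)
    proof induction
      case (mult x y)
      then show ?case
        using ideal_product.mult[OF I.ideal_mult[OF that(1)]] by (metis mult.assoc)
    qed (auto simp: distrib_left intro: ideal_product.add)
  qed (rule ideal_product.add)
qed

context subring_ideal
begin

lemma subring_ideal_power: "subring_ideal R (ideal_power R I n)"
  by (induction n) (auto intro: subring_ideal_self subring_ideal_product subring_ideal_axioms)

lemma power_in_ideal_power: "x \<in> I \<Longrightarrow> x ^ n \<in> ideal_power R I n"
  by (induction n) (auto intro: one_mem ideal_product.mult)

lemma ideal_power_Suc_subset: "x \<in> ideal_power R I (Suc n) \<Longrightarrow> x \<in> ideal_power R I n"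
proof -
  assume "x \<in> ideal_power R I (Suc n)"
  then have "x \<in> ideal_product I (ideal_power R I n)" by simp
  then show ?thesis
    by induction (auto intro: subring_ideal.ideal_mult[OF subring_ideal_power] ideal_sub
        subring_ideal.ideal_add[OF subring_ideal_power])
qed

lemma one_minus_power_mem:
  assumes "w \<in> R" "1 - w \<in> I"
  shows "1 - w ^ n \<in> I"
proof (induction n)
  case (Suc n)
  have "1 - w ^ Suc n = (1 - w ^ n) + w ^ n * (1 - w)" by (simp add: algebra_simps)
  then show ?case
    using ideal_add[OF Suc ideal_mult[OF power_mem[OF assms(1)] assms(2)]] by metis
qed (simp add: ideal_zero)

text \<open>Once x is known to lie in I ^ n, \<open>(1 - w) * x\<close> lies in I ^ (n + 1) because
  1 - w is in I, and adding \<open>w * x\<close> gives x. This removes a factor that was introduced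
  only to clear denominators.\<close>

lemma ideal_power_cancel_unit:
  assumes "w \<in> R" "1 - w \<in> I" "x \<in> R" "w * x \<in> ideal_power R I n"
  shows "x \<in> ideal_power R I n"
  using assms(4)
proof (induction n)
  case 0
  then show ?case using assms(3) by simp
next
  case (Suc n)
  have "x \<in> ideal_power R I n"
    by (rule Suc.IH) (rule ideal_power_Suc_subset[OF Suc.prems])
  then have "(1 - w) * x \<in> ideal_power R I (Suc n)"
    using ideal_product.mult[OF assms(2)] by simp
  then have "(1 - w) * x + w * x \<in> ideal_power R I (Suc n)"
    using subring_ideal.ideal_add[OF subring_ideal_power] Suc.prems by blast
  then show ?case by (simp add: algebra_simps)
qed

end

section \<open>Polynomials with coefficients in an ideal\<close>

definition polys :: "'a :: idom set \<Rightarrow> 'a poly set" where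
  "polys I = {p. \<forall>i. coeff p i \<in> I}"

lemma polys_coeff: "p \<in> polys I \<Longrightarrow> coeff p i \<in> I"
  by (simp add: polys_def)

context subring_ideal
begin

lemma polys_mult: "p \<in> polys R \<Longrightarrow> q \<in> polys I \<Longrightarrow> p * q \<in> polys I"
  by (auto simp: polys_def coeff_mult intro!: ideal_sum ideal_mult)

lemma polys_add: "p \<in> polys I \<Longrightarrow> q \<in> polys I \<Longrightarrow> p + q \<in> polys I"
  by (auto simp: polys_def intro: ideal_add)

lemma polys_diff: "p \<in> polys I \<Longrightarrow> q \<in> polys I \<Longrightarrow> p - q \<in> polys I"
  by (auto simp: polys_def intro: ideal_diff)

lemma polys_smult: "r \<in> R \<Longrightarrow> p \<in> polys I \<Longrightarrow> smult r p \<in> polys I"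
  by (auto simp: polys_def intro: ideal_mult)

lemma polys_monom: "c \<in> I \<Longrightarrow> monom c n \<in> polys I"
  by (auto simp: polys_def intro: ideal_zero)

lemma polys_zero: "0 \<in> polys I"
  by (auto simp: polys_def intro: ideal_zero)

lemma polys_const: "c \<in> I \<Longrightarrow> [:c:] \<in> polys I"
  by (auto simp: polys_def coeff_pCons ideal_zero split: nat.splits)

lemma poly_polys_mem: "p \<in> polys I \<Longrightarrow> x \<in> R \<Longrightarrow> poly p x \<in> I"
  by (auto simp: poly_altdef polys_def intro!: ideal_sum ideal_mult_right power_mem)

lemma subring_ideal_polys: "subring_ideal (polys R) (polys I)"
proof -
  interpret R: subring_ideal R R by (rule subring_ideal_self)
  have "1 \<in> polys R" using R.polys_const[OF one_mem] by (simp add: one_pCons)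
  then show ?thesis
    by unfold_locales (auto intro: R.polys_diff R.polys_mult polys_mult polys_zero polys_add,
      auto simp: polys_def intro: ideal_sub)
qed

text \<open>Each step subtracts p times a monomial whose coefficient comes from f, so quotient and
  remainder inherit coefficients in the ideal I, not only in \<open>R\<close>.\<close>

lemma pseudo_division:
  assumes p: "p \<in> polys R" "degree p \<ge> 1" and f: "f \<in> polys I"
  obtains k q r where "smult (lead_coeff p ^ k) f = p * q + r"
    "q \<in> polys I" "r \<in> polys I" "degree r < degree p"
  using f
proof (induction "degree f" arbitrary: f thesis rule: less_induct)
  case less
  note f = less.prems(2)
  define l where "l = lead_coeff p"
  have lR: "l \<in> R" using p by (simp add: l_def polys_coeff)
  show ?case
  proof (cases "degree f < degree p")
    case True
    show ?thesis
      by (rule less.prems(1)[of 0 0 f]) (use f True polys_zero in auto)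
  next
    case False
    define e where "e = monom (lead_coeff f) (degree f - degree p)"
    define f' where "f' = smult l f - p * e"
    have eI: "e \<in> polys I" using f by (simp add: e_def polys_monom polys_coeff)
    have f'I: "f' \<in> polys I"
      unfolding f'_def using f lR p(1) eI by (intro polys_diff polys_smult polys_mult)
    have "degree f' < degree f"
    proof (rule degree_lessI)
      show "f' \<noteq> 0 \<or> 0 < degree f" using False p(2) by simp
      show "\<forall>k\<ge>degree f. coeff f' k = 0"
      proof (intro allI impI)
        fix k assume k: "k \<ge> degree f"
        have "coeff (p * e) k = coeff p (k - (degree f - degree p)) * lead_coeff f"
          using k unfolding e_def by (subst (1) mult.commute, subst coeff_monom_mult) simp
        moreover have "coeff p (k - (degree f - degree p)) = 0" if "k > degree f"
          using that False by (intro coeff_eq_0) linarith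
        moreover have "coeff f k = 0" if "k > degree f" using that by (rule coeff_eq_0)
        ultimately show "coeff f' k = 0"
          using k False by (cases "k = degree f") (auto simp: f'_def l_def)
      qed
    qed
    from less.hyps[OF this _ f'I] obtain k q r where *: "smult (l ^ k) f' = p * q + r"
      "q \<in> polys I" "r \<in> polys I" "degree r < degree p" unfolding l_def by metis
    show ?thesis
    proof (rule less.prems(1)[of "Suc k" "smult (l ^ k) e + q" r])
      have "smult (l ^ Suc k) f = smult (l ^ k) (f' + p * e)"
        by (simp add: f'_def mult.commute)
      also have "\<dots> = p * (smult (l ^ k) e + q) + r"
        using *(1) by (simp add: smult_add_right algebra_simps)
      finally show "smult (lead_coeff p ^ Suc k) f = p * (smult (l ^ k) e + q) + r"
        by (simp add: l_def)
    qed (use * eI lR in \<open>auto intro: polys_add polys_smult power_mem\<close>)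
  qed
qed

text \<open>Division by a monic polynomial has a unique remainder: by its degree,
  \<open>F * Q + e\<close> must be the remainder of e, which has coefficients in I.\<close>

lemma polys_reduce_monic:
  assumes F: "F \<in> polys R" "lead_coeff F = 1" and Q: "Q \<in> polys R"
    and e: "e \<in> polys I" and deg: "degree (F * Q + e) < degree F"
  shows "F * Q + e \<in> polys I"
proof -
  obtain k q r where *: "smult (lead_coeff F ^ k) e = F * q + r" "r \<in> polys I" "degree r < degree F"
    by (rule pseudo_division[OF F(1) _ e]) (use deg in auto)
  have eq: "F * Q + e - r = F * (Q + q)" using * F(2) by (simp add: algebra_simps)
  have "Q + q = 0"
  proof (rule ccontr)
    assume nz: "Q + q \<noteq> 0"
    have "degree (F * (Q + q)) = degree F + degree (Q + q)"
      by (rule degree_mult_eq) (use F(2) nz in auto)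
    moreover have "degree (F * Q + e - r) < degree F"
      using deg *(3) by (intro degree_diff_less)
    ultimately show False by (simp add: eq)
  qed
  then have "F * Q + e = r" using eq by simp
  with * show ?thesis by simp
qed

end

section \<open>Finite index and submultiplicative sizes\<close>

definition finite_index :: "'a :: idom set \<Rightarrow> 'a set \<Rightarrow> bool" where
  "finite_index R I \<longleftrightarrow> (\<exists>F. finite F \<and> F \<subseteq> R \<and> (\<forall>x\<in>R. \<exists>y\<in>F. x - y \<in> I))"

text \<open>An l1 norm in which the indeterminate has size w. Weight 2 lets the size bound the
  degree; a larger weight makes reduction by a monic relation size-decreasing in the weak
  sense.\<close>

definition poly_size :: "('a :: idom \<Rightarrow> nat) \<Rightarrow> nat \<Rightarrow> 'a poly \<Rightarrow> nat" where
  "poly_size N w p = (\<Sum>i\<le>degree p. N (coeff p i) * w ^ i)"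

locale sized_ring = subring R for R :: "'a :: idom set" +
  fixes N :: "'a \<Rightarrow> nat"
  assumes size_eq_0: "x \<in> R \<Longrightarrow> N x = 0 \<longleftrightarrow> x = 0"
    and size_uminus: "x \<in> R \<Longrightarrow> N (- x) = N x"
    and size_add: "x \<in> R \<Longrightarrow> y \<in> R \<Longrightarrow> N (x + y) \<le> N x + N y"
    and size_mult: "x \<in> R \<Longrightarrow> y \<in> R \<Longrightarrow> N (x * y) \<le> N x * N y"
    and size_one: "N 1 = 1"
begin

lemma size_zero: "N 0 = 0"
  using size_eq_0[OF zero_mem] by simp

lemma size_sum: "(\<And>i. i \<in> A \<Longrightarrow> f i \<in> R) \<Longrightarrow> N (sum f A) \<le> (\<Sum>i\<in>A. N (f i))"
proof (induction A rule: infinite_finite_induct)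
  case (insert x A)
  have "N (f x + sum f A) \<le> N (f x) + N (sum f A)"
    using insert.prems by (intro size_add sum_mem) auto
  then show ?case using insert by fastforce
qed (auto simp: size_zero)

lemma size_of_nat: "N (of_nat n) \<le> n"
proof (induction n)
  case (Suc n)
  have "N (1 + of_nat n) \<le> N 1 + N (of_nat n)" by (intro size_add mems)
  then show ?case using Suc by (simp add: size_one)
qed (simp add: size_zero)

lemma size_power: "x \<in> R \<Longrightarrow> N (x ^ n) \<le> N x ^ n"
proof (induction n)
  case (Suc n)
  have "N (x * x ^ n) \<le> N x * N (x ^ n)" using Suc.prems by (intro size_mult mems)
  also have "\<dots> \<le> N x * N x ^ n" using Suc by simp
  finally show ?case by simp
qed (simp add: size_one)

lemma poly_size_bound:
  assumes "degree p \<le> n"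
  shows "poly_size N w p = (\<Sum>i\<le>n. N (coeff p i) * w ^ i)"
  unfolding poly_size_def
  by (rule sum.mono_neutral_left) (use assms in \<open>auto simp: size_zero intro!: le_degree\<close>)

lemma poly_size_add:
  assumes "p \<in> polys R" "q \<in> polys R"
  shows "poly_size N w (p + q) \<le> poly_size N w p + poly_size N w q"
proof -
  let ?n = "max (degree p) (degree q)"
  have "poly_size N w (p + q) = (\<Sum>i\<le>?n. N (coeff p i + coeff q i) * w ^ i)"
    by (subst poly_size_bound[of _ ?n]) (auto intro: degree_add_le)
  also have "\<dots> \<le> (\<Sum>i\<le>?n. (N (coeff p i) + N (coeff q i)) * w ^ i)"
    using assms by (intro sum_mono mult_right_mono size_add) (auto simp: polys_coeff)
  also have "\<dots> = poly_size N w p + poly_size N w q"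
    by (subst (1 2) poly_size_bound[of _ ?n]) (auto simp: distrib_right sum.distrib)
  finally show ?thesis .
qed

lemma poly_size_uminus: "p \<in> polys R \<Longrightarrow> poly_size N w (- p) = poly_size N w p"
  by (simp add: poly_size_def size_uminus polys_coeff)

lemma poly_size_monom_mult:
  assumes "c \<in> R" "p \<in> polys R"
  shows "poly_size N w (monom c n * p) \<le> N c * w ^ n * poly_size N w p"
proof -
  have "poly_size N w (monom c n * p) = (\<Sum>i\<le>n + degree p. N (coeff (monom c n * p) i) * w ^ i)"
    by (rule poly_size_bound) (metis add_mono_thms_linordered_semiring(3) degree_monom_le degree_mult_le order.trans)
  also have "\<dots> = (\<Sum>i\<in>{n..n + degree p}. N (coeff (monom c n * p) i) * w ^ i)"
    by (rule sum.mono_neutral_right) (auto simp: coeff_monom_mult size_zero)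
  also have "\<dots> = (\<Sum>i\<le>degree p. N (c * coeff p i) * w ^ (n + i))"
    by (rule sum.reindex_bij_witness[of _ "\<lambda>i. n + i" "\<lambda>i. i - n"]) (auto simp: coeff_monom_mult)
  also have "\<dots> \<le> (\<Sum>i\<le>degree p. N c * w ^ n * (N (coeff p i) * w ^ i))"
  proof (rule sum_mono)
    fix i
    have "N (c * coeff p i) \<le> N c * N (coeff p i)"
      using assms by (intro size_mult polys_coeff)
    then have "N (c * coeff p i) * w ^ (n + i) \<le> (N c * N (coeff p i)) * w ^ (n + i)"
      by (rule mult_right_mono) simp
    then show "N (c * coeff p i) * w ^ (n + i) \<le> N c * w ^ n * (N (coeff p i) * w ^ i)"
      by (simp add: power_add mult_ac)
  qed
  also have "\<dots> = N c * w ^ n * poly_size N w p"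
    by (simp add: poly_size_def sum_distrib_left)
  finally show ?thesis .
qed

lemma poly_size_sum:
  "(\<And>i. i \<in> A \<Longrightarrow> f i \<in> polys R) \<Longrightarrow> poly_size N w (sum f A) \<le> (\<Sum>i\<in>A. poly_size N w (f i))"
proof (induction A rule: infinite_finite_induct)
  case (insert x A)
  interpret P: subring_ideal "polys R" "polys R"
    by (intro subring_ideal.subring_ideal_polys subring_ideal_self)
  have "poly_size N w (f x + sum f A) \<le> poly_size N w (f x) + poly_size N w (sum f A)"
    using insert.prems by (intro poly_size_add P.sum_mem) auto
  then show ?case using insert by fastforce
qed (auto simp: poly_size_def size_zero)

lemma poly_size_mult:
  assumes "p \<in> polys R" "q \<in> polys R"
  shows "poly_size N w (p * q) \<le> poly_size N w p * poly_size N w q"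
proof -
  interpret R: subring_ideal R R by (rule subring_ideal_self)
  have "p * q = (\<Sum>i\<le>degree p. monom (coeff p i) i * q)"
    by (subst (1) poly_as_sum_of_monoms[symmetric]) (simp add: sum_distrib_right)
  then have "poly_size N w (p * q) \<le> (\<Sum>i\<le>degree p. poly_size N w (monom (coeff p i) i * q))"
    using assms by (auto intro!: poly_size_sum R.polys_mult R.polys_monom polys_coeff)
  also have "\<dots> \<le> (\<Sum>i\<le>degree p. N (coeff p i) * w ^ i * poly_size N w q)"
    using assms by (intro sum_mono poly_size_monom_mult polys_coeff)
  finally show ?thesis by (simp add: poly_size_def sum_distrib_right)
qed

lemma poly_size_coeff_le:
  assumes "w \<ge> 1"
  shows "N (coeff p i) * w ^ i \<le> poly_size N w p"
proof (cases "i \<le> degree p")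
  case True
  then show ?thesis unfolding poly_size_def
    by (intro member_le_sum) auto
qed (simp add: coeff_eq_0 size_zero)

lemma poly_size_coeff_le':
  assumes "w \<ge> 1"
  shows "N (coeff p i) \<le> poly_size N w p"
  using poly_size_coeff_le[OF assms, of p i] assms
  by (metis le_trans mult_le_mono2 nat_mult_1_right one_le_power)

lemma poly_size_eq_0:
  assumes "w \<ge> 1" "p \<in> polys R"
  shows "poly_size N w p = 0 \<longleftrightarrow> p = 0"
proof
  assume "poly_size N w p = 0"
  then have "N (lead_coeff p) = 0"
    using poly_size_coeff_le'[OF assms(1), of p "degree p"] by simp
  then show "p = 0" using size_eq_0[OF polys_coeff[OF assms(2)]] by simp
qed (simp add: poly_size_def size_zero)

lemma poly_size_one: "poly_size N w 1 = 1"
  by (simp add: poly_size_def size_one)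

end

section \<open>Rings with separating ideals\<close>

text \<open>\<open>S\<close> is universally quantified and I may depend on it. The clause on \<rho>
  says that \<rho> becomes a unit modulo I; it is also what the induction over adjoined elements
  consumes, units for the larger ring being obtained from units for the smaller one.\<close>

locale separated_ring = sized_ring +
  assumes separating: "\<rho> \<in> R \<Longrightarrow> \<rho> \<noteq> 0 \<Longrightarrow> \<exists>I. subring_ideal R I \<and> finite_index R I \<and> (\<exists>\<sigma>\<in>R. \<rho> * \<sigma> - 1 \<in> I) \<and>
    (\<exists>n0. \<forall>n\<ge>n0. \<forall>x\<in>ideal_power R I n. N x \<le> S ^ n \<longrightarrow> x = 0)"

text \<open>A nonzero element of the n-th power of a principal ideal (m) has absolute value at least
  m ^ n, so any m > S separates.\<close>

lemma separated_ring_Ints: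
  "separated_ring (\<int> :: 'a :: field_char_0 set) (\<lambda>x. nat \<bar>THE k. x = of_int k\<bar>)"
    (is "separated_ring _ ?N")
proof -
  have N: "?N (of_int k :: 'a) = nat \<bar>k\<bar>" for k
    by simp
  interpret subring "\<int> :: 'a set"
    by unfold_locales auto
  interpret sized_ring "\<int> :: 'a set" ?N
  proof
    fix x y :: 'a assume "x \<in> \<int>" "y \<in> \<int>"
    then obtain k l where xy: "x = of_int k" "y = of_int l" by (auto elim!: Ints_cases)
    show "?N x = 0 \<longleftrightarrow> x = 0" unfolding xy N by simp
    show "?N (- x) = ?N x" unfolding xy of_int_minus[symmetric] N by simp
    show "?N (x + y) \<le> ?N x + ?N y" unfolding xy of_int_add[symmetric] N by linarith
    show "?N (x * y) \<le> ?N x * ?N y"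
      unfolding xy of_int_mult[symmetric] N by (simp add: abs_mult nat_mult_distrib)
  next
    show "?N 1 = 1" using N[of 1] by simp
  qed
  show ?thesis
  proof
    fix \<rho> :: 'a and S :: nat assume "\<rho> \<in> \<int>" "\<rho> \<noteq> 0"
    then obtain r where r: "\<rho> = of_int r" "r \<noteq> 0" by (auto elim!: Ints_cases)
    \<comment> \<open>The modulus is 1 modulo r, hence r is invertible modulo m, and it exceeds
      S.\<close>
    define m where "m = \<bar>r\<bar> * (int S + 1) + 1"
    have "1 * (int S + 1) \<le> m - 1"
      unfolding m_def add_diff_cancel_right' using r(2) by (intro mult_right_mono) auto
    then have mS: "m > int S" by simp
    define I where "I = {of_int (m * k) :: 'a | k. True}"
    have I: "subring_ideal \<int> I"
    proof
      show "0 \<in> I" unfolding I_def by (force intro: exI[of _ 0])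
      show "x \<in> \<int>" if "x \<in> I" for x using that unfolding I_def by auto
      show "x + y \<in> I" if "x \<in> I" "y \<in> I" for x y
        using that unfolding I_def
        by (clarsimp simp flip: of_int_add of_int_mult) (metis distrib_left)
      show "z * x \<in> I" if "z \<in> \<int>" "x \<in> I" for z x
        using that unfolding I_def
        by (clarsimp elim!: Ints_cases simp flip: of_int_add of_int_mult; metis mult.left_commute)
    qed
    have "finite_index \<int> I" unfolding finite_index_def
    proof (intro exI conjI ballI)
      show "finite (of_int ` {0..<m} :: 'a set)" by simp
      show "of_int ` {0..<m} \<subseteq> (\<int> :: 'a set)" by auto
      fix x :: 'a assume "x \<in> \<int>"
      then obtain k where k: "x = of_int k" by (auto elim!: Ints_cases)
      show "\<exists>y\<in>of_int ` {0..<m}. x - y \<in> I"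
      proof
        show "(of_int (k mod m) :: 'a) \<in> of_int ` {0..<m}" using mS by simp
        have "k - k mod m = m * (k div m)" by (simp add: minus_mod_eq_mult_div)
        then show "x - of_int (k mod m) \<in> I" unfolding k I_def
          by (metis (mono_tags, lifting) mem_Collect_eq of_int_diff)
      qed
    qed
    moreover have "\<exists>\<sigma>\<in>\<int>. \<rho> * \<sigma> - 1 \<in> I"
    proof
      have "r * (- sgn r * (int S + 1)) - 1 = m * (- 1)"
        by (simp add: m_def abs_sgn algebra_simps)
      then show "\<rho> * of_int (- sgn r * (int S + 1)) - 1 \<in> I" unfolding r I_def
        by (metis (mono_tags, lifting) mem_Collect_eq of_int_1 of_int_diff of_int_mult)
    qed auto
    moreover have "x = 0" if "n \<ge> 1" "x \<in> ideal_power \<int> I n" "?N x \<le> S ^ n" for n x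
    proof -
      have "\<exists>k. x = of_int (m ^ n * k)"
        using that(2)
      proof (induction n arbitrary: x)
        case 0
        then show ?case by (auto elim: Ints_cases)
      next
        case (Suc n)
        from Suc.prems have "x \<in> ideal_product I (ideal_power \<int> I n)" by simp
        then show ?case
        proof induction
          case (mult u v)
          then obtain k l where "u = of_int (m * k)" "v = of_int (m ^ n * l)"
            using Suc.IH unfolding I_def by blast
          then have "u * v = of_int (m ^ Suc n * (k * l))" by simp
          then show ?case by blast
        next
          case (add u v)
          then show ?case by (metis distrib_left of_int_add)
        qed
      qed
      then obtain k where k: "x = of_int (m ^ n * k)" by blast
      have "nat \<bar>m ^ n * k\<bar> \<le> S ^ n" using that(3) unfolding k N .
      then have "\<bar>m ^ n * k\<bar> \<le> int (S ^ n)" by linarith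
      also have "\<dots> < m ^ n" using mS that(1) by (simp add: power_strict_mono)
      finally have "\<bar>k\<bar> * m ^ n < 1 * m ^ n" using mS by (simp add: abs_mult mult.commute)
      then have "k = 0" using mS by (simp add: mult_less_cancel_right)
      then show "x = 0" by (simp add: k)
    qed
    ultimately show "\<exists>I. subring_ideal \<int> I \<and> finite_index \<int> I \<and> (\<exists>\<sigma>\<in>\<int>. \<rho> * \<sigma> - 1 \<in> I) \<and>
        (\<exists>n0. \<forall>n\<ge>n0. \<forall>x\<in>ideal_power \<int> I n. ?N x \<le> S ^ n \<longrightarrow> x = 0)"
      using I by blast
  qed
qed

section \<open>Adjoining one element: the ring and its size\<close>

definition adjoin :: "'a :: idom set \<Rightarrow> 'a \<Rightarrow> 'a set" where
  "adjoin R t = (\<lambda>p. poly p t) ` polys R"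

lemma adjoinI: "p \<in> polys R \<Longrightarrow> poly p t \<in> adjoin R t"
  by (simp add: adjoin_def)

text \<open>Meaningful when \<open>P\<close> contains exactly one representative of each element of \<open>adjoin R t\<close>.\<close>

definition adjoin_size :: "('a :: idom \<Rightarrow> nat) \<Rightarrow> nat \<Rightarrow> 'a poly set \<Rightarrow> 'a \<Rightarrow> 'a \<Rightarrow> nat" where
  "adjoin_size N w P t x = poly_size N w (THE p. p \<in> P \<and> poly p t = x)"

lemma adjoin_size_poly:
  assumes "inj_on (\<lambda>p. poly p t) P" "p \<in> P"
  shows "adjoin_size N w P t (poly p t) = poly_size N w p"
proof -
  have "(THE p'. p' \<in> P \<and> poly p' t = poly p t) = p"
    using assms by (auto intro!: the_equality dest: inj_onD)
  then show ?thesis by (simp add: adjoin_size_def)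
qed

context subring
begin

interpretation polys: subring_ideal "polys R" "polys R"
  by (intro subring_ideal.subring_ideal_polys subring_ideal_self)

interpretation self: subring_ideal R R
  by (rule subring_ideal_self)

lemma subring_adjoin: "subring (adjoin R t)"
proof
  show "1 \<in> adjoin R t" using adjoinI[OF polys.one_mem, of t] by simp
  fix x y assume "x \<in> adjoin R t" "y \<in> adjoin R t"
  then obtain p q where *: "p \<in> polys R" "q \<in> polys R" "x = poly p t" "y = poly q t"
    by (auto simp: adjoin_def)
  show "x - y \<in> adjoin R t" using adjoinI[OF polys.diff_mem[OF *(1,2)], of t] * by simp
  show "x * y \<in> adjoin R t" using adjoinI[OF polys.mult_mem[OF *(1,2)], of t] * by simp
qed

lemma subset_adjoin: "x \<in> R \<Longrightarrow> x \<in> adjoin R t"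
  using adjoinI[OF self.polys_const, of x t] by simp

lemma generator_in_adjoin: "t \<in> adjoin R t"
  using adjoinI[OF self.polys_monom[OF one_mem], of 1 t] by (simp add: poly_monom)

end

context sized_ring
begin

interpretation polys: subring_ideal "polys R" "polys R"
  by (intro subring_ideal.subring_ideal_polys subring_ideal_self)

interpretation self: subring_ideal R R
  by (rule subring_ideal_self)

text \<open>\<open>P\<close> is a system of normal forms. The inequalities descend from polynomials
  to their values because passing to the normal form does not increase the size.\<close>

lemma sized_ring_adjoin:
  assumes w: "w \<ge> 1" and P: "P \<subseteq> polys R" "1 \<in> P" "\<And>p. p \<in> P \<Longrightarrow> - p \<in> P"
    and inj: "inj_on (\<lambda>p. poly p t) P"
    and red: "\<And>p. p \<in> polys R \<Longrightarrow> \<exists>q\<in>P. poly q t = poly p t \<and> poly_size N w q \<le> poly_size N w p"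
  shows "sized_ring (adjoin R t) (adjoin_size N w P t)"
proof -
  interpret A: subring "adjoin R t" by (rule subring_adjoin)
  have rep: "\<exists>p\<in>P. x = poly p t" if "x \<in> adjoin R t" for x
    using that red unfolding adjoin_def by (metis imageE)
  have le: "adjoin_size N w P t (poly p t) \<le> poly_size N w p" if "p \<in> polys R" for p
    using red[OF that] adjoin_size_poly[OF inj] by metis
  show ?thesis
  proof
    fix x y assume "x \<in> adjoin R t" "y \<in> adjoin R t"
    then obtain p q where *: "p \<in> P" "q \<in> P" "x = poly p t" "y = poly q t"
      using rep by metis
    then have pq: "p \<in> polys R" "q \<in> polys R" using P(1) by auto
    note sz = adjoin_size_poly[OF inj *(1), of N w] adjoin_size_poly[OF inj *(2), of N w]
      adjoin_size_poly[OF inj P(3)[OF *(1)], of N w]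
    show "adjoin_size N w P t (x + y) \<le> adjoin_size N w P t x + adjoin_size N w P t y"
      using le[OF polys.add_mem[OF pq]] poly_size_add[OF pq, of w] by (simp add: * sz)
    show "adjoin_size N w P t (x * y) \<le> adjoin_size N w P t x * adjoin_size N w P t y"
      using le[OF polys.mult_mem[OF pq]] poly_size_mult[OF pq, of w] by (simp add: * sz)
    show "adjoin_size N w P t (- x) = adjoin_size N w P t x"
      using sz poly_size_uminus[OF pq(1), of w] by (simp add: *)
    show "adjoin_size N w P t x = 0 \<longleftrightarrow> x = 0"
    proof
      assume "adjoin_size N w P t x = 0"
      then have "p = 0" using sz poly_size_eq_0[OF w pq(1)] by (simp add: *)
      then show "x = 0" by (simp add: *)
    next
      assume "x = 0"
      then show "adjoin_size N w P t x = 0"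
        using le[OF polys.zero_mem] by (simp add: poly_size_def size_zero)
    qed
  next
    show "adjoin_size N w P t 1 = 1"
      using adjoin_size_poly[OF inj P(2), of N w] by (simp add: poly_size_one)
  qed
qed

end

section \<open>Adjoining one element: ideals generated by I and a value F(t)\<close>

definition adjoin_ideal :: "'a :: idom set \<Rightarrow> 'a set \<Rightarrow> 'a poly \<Rightarrow> 'a \<Rightarrow> 'a set" where
  "adjoin_ideal R I F t = {poly (e + F * q) t | e q. e \<in> polys I \<and> q \<in> polys R}"

lemma adjoin_idealI: "e \<in> polys I \<Longrightarrow> q \<in> polys R \<Longrightarrow> x = poly (e + F * q) t \<Longrightarrow> x \<in> adjoin_ideal R I F t"
  by (auto simp: adjoin_ideal_def)

context subring_ideal
begin

interpretation polys: subring_ideal "polys R" "polys R"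
  by (intro subring_ideal.subring_ideal_polys subring_ideal_self)

interpretation self: subring_ideal R R
  by (rule subring_ideal_self)

lemma subring_ideal_adjoin:
  assumes F: "F \<in> polys R"
  shows "subring_ideal (adjoin R t) (adjoin_ideal R I F t)"
proof -
  interpret A: subring "adjoin R t" by (rule subring_adjoin)
  show ?thesis
  proof
    show "0 \<in> adjoin_ideal R I F t"
      by (rule adjoin_idealI[OF polys_zero polys.zero_mem]) simp
  next
    fix x assume "x \<in> adjoin_ideal R I F t"
    then obtain e q where x: "x = poly (e + F * q) t" "e \<in> polys I" "q \<in> polys R"
      by (auto simp: adjoin_ideal_def)
    then have "e \<in> polys R" by (auto simp: polys_def ideal_sub)
    then show "x \<in> adjoin R t" using x F by (auto intro!: adjoinI polys.mems simp del: poly_add poly_mult)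
    show "x + y \<in> adjoin_ideal R I F t" if "y \<in> adjoin_ideal R I F t" for y
    proof -
      from that obtain e' q' where "y = poly (e' + F * q') t" "e' \<in> polys I" "q' \<in> polys R"
        by (auto simp: adjoin_ideal_def)
      then show ?thesis using x
        by (intro adjoin_idealI[of "e + e'" _ "q + q'"]) (auto intro: polys_add polys.add_mem simp: algebra_simps)
    qed
    show "z * x \<in> adjoin_ideal R I F t" if z: "z \<in> adjoin R t" for z
    proof -
      from that obtain p where "p \<in> polys R" "z = poly p t" by (auto simp: adjoin_def)
      then show ?thesis using x
        by (intro adjoin_idealI[of "p * e" _ "p * q"] polys_mult polys.mult_mem) (auto simp: algebra_simps)
    qed
  qed
qed

text \<open>Dividing by the monic F leaves finitely many coefficients, each of which can be replaced
  by one of finitely many representatives modulo I.\<close>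

lemma finite_index_adjoin:
  assumes F: "F \<in> polys R" "lead_coeff F = 1" "degree F \<ge> 1" and fin: "finite_index R I"
  shows "finite_index (adjoin R t) (adjoin_ideal R I F t)"
proof -
  from fin obtain X where X: "finite X" "X \<subseteq> R" "\<And>x. x \<in> R \<Longrightarrow> \<exists>y\<in>X. x - y \<in> I"
    unfolding finite_index_def by blast
  let ?D = "degree F"
  define G where "G = (\<lambda>f. \<Sum>i<?D. f i * t ^ i) ` (PiE {..<?D} (\<lambda>_. X))"
  interpret A: subring "adjoin R t" by (rule subring_adjoin)
  show ?thesis unfolding finite_index_def
  proof (intro exI[of _ G] conjI ballI)
    show "finite G" unfolding G_def using X(1) by (intro finite_imageI finite_PiE) auto
    show "G \<subseteq> adjoin R t" unfolding G_def using X(2)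
      by (auto simp: PiE_iff intro!: A.sum_mem A.mult_mem A.power_mem generator_in_adjoin intro: subset_adjoin)
    fix x assume "x \<in> adjoin R t"
    then obtain p where p: "p \<in> polys R" "x = poly p t" by (auto simp: adjoin_def)
    obtain k q r where kqr: "smult (lead_coeff F ^ k) p = F * q + r" "q \<in> polys R" "r \<in> polys R" "degree r < ?D"
      by (rule self.pseudo_division[OF F(1,3) p(1)])
    have "\<forall>i. \<exists>y\<in>X. coeff r i - y \<in> I" using X(3) polys_coeff[OF kqr(3)] by blast
    then obtain f where f: "\<And>i. f i \<in> X" "\<And>i. coeff r i - f i \<in> I" by metis
    let ?y = "\<Sum>i<?D. restrict f {..<?D} i * t ^ i"
    show "\<exists>y\<in>G. x - y \<in> adjoin_ideal R I F t"
    proof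
      show "?y \<in> G" unfolding G_def by (rule imageI, subst restrict_PiE_iff) (use f in auto)
      define e where "e = (\<Sum>i<?D. monom (coeff r i - f i) i)"
      have "poly r t = (\<Sum>i<?D. coeff r i * t ^ i)"
        unfolding poly_altdef using kqr(4)
        by (intro sum.mono_neutral_left) (auto simp: not_le intro: coeff_eq_0)
      then have "x - ?y = poly (e + F * q) t"
        using kqr(1) F(2) p(2)
        by (simp add: e_def poly_sum poly_monom sum_subtractf algebra_simps)
      moreover have "e \<in> polys I"
        unfolding e_def polys_def by (auto simp: coeff_sum intro!: ideal_sum f ideal_zero)
      ultimately show "x - ?y \<in> adjoin_ideal R I F t" using kqr(2) by (auto intro: adjoin_idealI)
    qed
  qed
qed

lemma polys_ideal_product:
  assumes "p \<in> polys I" "q \<in> polys (ideal_power R I n)"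
  shows "p * q \<in> polys (ideal_power R I (Suc n))"
proof -
  interpret J: subring_ideal R "ideal_power R I (Suc n)" by (rule subring_ideal_power)
  show ?thesis
    using assms
    by (auto simp: polys_def coeff_mult simp del: ideal_power.simps intro!: J.ideal_sum)
      (auto intro: ideal_product.mult)
qed

lemma polys_ideal_sub: "p \<in> polys I \<Longrightarrow> p \<in> polys R"
  by (auto simp: polys_def ideal_sub)

text \<open>A product of n generators has either at least h factors F or more than n - h factors
  from I. All h are treated at once because the induction step uses h and h - 1 together.\<close>

lemma adjoin_ideal_power_cases:
  assumes F: "F \<in> polys R" and x: "x \<in> ideal_power (adjoin R t) (adjoin_ideal R I F t) n" and h: "h \<le> n"
  shows "\<exists>e\<in>polys (ideal_power R I (n - h)). \<exists>q\<in>polys R. x = poly (e + F ^ h * q) t"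
  using x h
proof (induction n arbitrary: x h)
  case 0
  then obtain p where "p \<in> polys R" "x = poly p t" by (auto simp: adjoin_def)
  with 0 show ?case by (intro bexI[of _ 0] bexI[of _ p]) (auto simp: polys.zero_mem)
next
  case (Suc n)
  note ideal = subring_ideal_power[of "Suc n - h"]
  interpret L: subring_ideal R "ideal_power R I (Suc n - h)" by (rule ideal)
  from Suc.prems(1) have
    "x \<in> ideal_product (adjoin_ideal R I F t) (ideal_power (adjoin R t) (adjoin_ideal R I F t) n)" by simp
  then show ?case
  proof induction
    case (mult u v)
    from mult(1) obtain e q where u: "u = poly (e + F * q) t" "e \<in> polys I" "q \<in> polys R"
      by (auto simp: adjoin_ideal_def)
    have eR: "e \<in> polys R" using u(2) by (rule polys_ideal_sub)
    show ?case
    proof (cases h)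
      case 0
      obtain e2 q2 where v: "e2 \<in> polys (ideal_power R I n)" "q2 \<in> polys R" "v = poly (e2 + F ^ 0 * q2) t"
        using Suc.IH[OF mult(2), of 0] by auto
      have "e2 \<in> polys R"
        using v(1) subring_ideal.polys_ideal_sub[OF subring_ideal_power] by blast
      then show ?thesis using 0 u v eR F
        by (intro bexI[of _ 0] bexI[of _ "(e + F * q) * (e2 + q2)"] L.polys_zero polys.mult_mem polys.add_mem) auto
    next
      case (Suc h')
      then have h': "h' \<le> n" "Suc n - h = n - h'" using Suc.prems(2) by auto
      obtain e1 q1 where v1: "e1 \<in> polys (ideal_power R I (n - h'))" "q1 \<in> polys R"
        "v = poly (e1 + F ^ h' * q1) t"
        using Suc.IH[OF mult(2) h'(1)] by blast
      have e1: "F * q * e1 \<in> polys (ideal_power R I (n - h'))"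
        using subring_ideal.polys_mult[OF subring_ideal_power] F u(3) v1(1) polys.mult_mem by blast
      show ?thesis
      proof (cases "h \<le> n")
        case True
        obtain e2 q2 where v2: "e2 \<in> polys (ideal_power R I (n - h))" "q2 \<in> polys R"
          "v = poly (e2 + F ^ h * q2) t"
          using Suc.IH[OF mult(2) True] by blast
        have "e * e2 \<in> polys (ideal_power R I (n - h'))"
          using polys_ideal_product[OF u(2) v2(1)] True Suc by (simp add: Suc_diff_le[symmetric] del: ideal_power.simps)
        \<comment> \<open>Two decompositions of v are used: \<open>F * q\<close> multiplies the one
          for h - 1 and supplies the missing F, e multiplies the one for h and supplies the missing
          factor from I.\<close>
        moreover have "u * v = poly (F * q) t * poly (e1 + F ^ h' * q1) t + poly e t * poly (e2 + F ^ h * q2) t"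
          using u(1) v1(3) v2(3) by (simp add: algebra_simps)
        then have "u * v = poly ((F * q * e1 + e * e2) + F ^ h * (q * q1 + e * q2)) t"
          using Suc by (simp add: algebra_simps)
        ultimately show ?thesis using e1 u v1 v2 eR h'(2)
          by (intro bexI[of _ "F * q * e1 + e * e2"] bexI[of _ "q * q1 + e * q2"] L.polys_add
              polys.add_mem polys.mult_mem) auto
      next
        case False
        then have [simp]: "h' = n" "h = Suc n" using Suc h' by auto
        have "u * v = poly ((F * q * e1 + e * (e1 + F ^ h' * q1)) + F ^ h * (q * q1)) t"
          using u v1 by (simp add: algebra_simps)
        moreover have "(F * q * e1 + e * (e1 + F ^ h' * q1)) \<in> polys R"
          using e1 eR u v1 F by (intro polys.add_mem polys.mult_mem polys.power_mem) auto
        ultimately show ?thesis using u v1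
          by (intro bexI[of _ "F * q * e1 + e * (e1 + F ^ h' * q1)"] bexI[of _ "q * q1"] polys.mult_mem) auto
      qed
    qed
  next
    case (add u v)
    then obtain e q e' q' where "e \<in> polys (ideal_power R I (Suc n - h))" "q \<in> polys R" "u = poly (e + F ^ h * q) t"
      "e' \<in> polys (ideal_power R I (Suc n - h))" "q' \<in> polys R" "v = poly (e' + F ^ h * q') t" by metis
    then show ?case
      by (intro bexI[of _ "e + e'"] bexI[of _ "q + q'"] L.polys_add polys.add_mem) (auto simp: algebra_simps)
  qed
qed

lemma adjoin_ideal_power_cases_root:
  assumes F: "F \<in> polys R" "poly F t = 0" and x: "x \<in> ideal_power (adjoin R t) (adjoin_ideal R I F t) n"
  shows "\<exists>e\<in>polys (ideal_power R I n). x = poly e t"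
  using x
proof (induction n arbitrary: x)
  case (Suc n)
  interpret L: subring_ideal R "ideal_power R I (Suc n)" by (rule subring_ideal_power)
  from Suc.prems(1) have
    "x \<in> ideal_product (adjoin_ideal R I F t) (ideal_power (adjoin R t) (adjoin_ideal R I F t) n)" by simp
  then show ?case
  proof induction
    case (mult u v)
    from mult(1) obtain e where u: "u = poly e t" "e \<in> polys I"
      using F(2) by (auto simp: adjoin_ideal_def)
    from Suc.IH[OF mult(2)] obtain e' where "e' \<in> polys (ideal_power R I n)" "v = poly e' t" by blast
    then show ?case using u polys_ideal_product[of e e' n] by (intro bexI[of _ "e * e'"]) auto
  next
    case (add u v)
    then obtain e e' where "e \<in> polys (ideal_power R I (Suc n))" "u = poly e t"
      "e' \<in> polys (ideal_power R I (Suc n))" "v = poly e' t" by metis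
    then show ?case by (intro bexI[of _ "e + e'"] L.polys_add) auto
  qed
qed (auto simp: adjoin_def)

text \<open>Modulo X - u the polynomial p is the constant p(u), a unit modulo I; inverses for the
  individual nodes are then combined.\<close>

lemma unit_mod_adjoin_ideal:
  assumes p: "p \<in> polys R" and "finite U"
    and unit: "\<And>u. u \<in> U \<Longrightarrow> \<exists>\<tau>\<in>R. poly p (of_nat u) * \<tau> - 1 \<in> I"
  shows "\<exists>a\<in>polys R. \<exists>e\<in>polys I. \<exists>q\<in>polys R. p * a - 1 = e + (\<Prod>u\<in>U. [:- of_nat u, 1:]) * q"
  using assms(2,3)
proof (induction U)
  case empty
  show ?case
    by (intro bexI[of _ 0] bexI[of _ "-1"]) (auto intro: polys_zero polys.mems)
next
  case (insert u U)
  define \<phi> where "\<phi> = (\<Prod>u\<in>U. [:- of_nat u, 1 :: 'a:])"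
  from insert obtain a e q where IH: "a \<in> polys R" "e \<in> polys I" "q \<in> polys R" "p * a - 1 = e + \<phi> * q"
    unfolding \<phi>_def by force
  obtain \<tau> where \<tau>: "\<tau> \<in> R" "poly p (of_nat u) * \<tau> - 1 \<in> I" using insert.prems by blast
  interpret self: subring_ideal R R by (rule subring_ideal_self)
  define X where "X = [:- of_nat u, 1 :: 'a:]"
  have X: "X \<in> polys R" unfolding X_def polys_def by (auto simp: coeff_pCons mems split: nat.split)
  obtain k s r where s: "smult (lead_coeff X ^ k) p = X * s + r" "s \<in> polys R" "degree r < degree X"
    by (rule self.pseudo_division[OF X _ p]) (auto simp: X_def)
  then obtain c where "r = [:c:]" by (auto simp: X_def elim: degree_eq_zeroE)
  with s have ps: "p = X * s + [:c:]" by (simp add: X_def)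
  have c: "poly p (of_nat u) = c" by (subst ps) (simp add: X_def)
  define e' where "e' = [:c * \<tau> - 1:]"
  have e': "e' \<in> polys I" unfolding e'_def using \<tau> c by (intro polys_const) simp
  have \<tau>R: "[:\<tau>:] \<in> polys R" by (rule self.polys_const[OF \<tau>(1)])
  have eq': "p * [:\<tau>:] - 1 = e' + X * (s * [:\<tau>:])"
    by (subst ps) (simp add: e'_def algebra_simps one_pCons)
  \<comment> \<open>If a and \<tau> invert p modulo two ideals, this a' inverts p modulo their
    product, since 1 - p a' is the product of 1 - p a and 1 - p \<tau>.\<close>
  define a' where "a' = a + [:\<tau>:] - p * a * [:\<tau>:]"
  have "p * a' - 1 = - (p * a - 1) * (p * [:\<tau>:] - 1)"
    unfolding a'_def by algebra
  also have "\<dots> = - (e * e' + (e * (X * (s * [:\<tau>:])) + (\<phi> * q) * e')) + (X * \<phi>) * (- (q * (s * [:\<tau>:])))"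
    unfolding IH(4) eq' by algebra
  finally have "p * a' - 1 = - (e * e' + (e * (X * (s * [:\<tau>:])) + (\<phi> * q) * e')) + (X * \<phi>) * (- (q * (s * [:\<tau>:])))" .
  moreover have "\<phi> \<in> polys R" unfolding \<phi>_def
    by (intro polys.prod_mem) (auto simp: polys_def coeff_pCons mems split: nat.split)
  then have "- (e * e' + (e * (X * (s * [:\<tau>:])) + (\<phi> * q) * e')) \<in> polys I"
    using IH e' X s \<tau>R polys_ideal_sub[OF IH(2)]
    by (intro subring_ideal.ideal_uminus[OF subring_ideal_polys] polys_add polys_mult[of _ e']
        subring_ideal.ideal_mult_right[OF subring_ideal_polys, of e] polys.mult_mem) auto
  moreover have "- (q * (s * [:\<tau>:])) \<in> polys R" "a' \<in> polys R"
    unfolding a'_def using IH(1,3) s(2) \<tau>R p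
    by (simp_all only: polys.uminus_mem polys.mult_mem polys.diff_mem polys.add_mem)
  moreover have "(\<Prod>u\<in>insert u U. [:- of_nat u, 1 :: 'a:]) = X * \<phi>"
    using insert by (simp add: X_def \<phi>_def)
  ultimately show ?case by metis
qed

end

text \<open>The new ideal is generated by \<open>I\<close> and \<open>\<phi> = (t - u\<^sub>1) \<cdots> (t - u\<^sub>M)\<close>. Modulo \<open>I ^ (n - h)\<close> an element of its
  \<open>n\<close>-th power is divisible by \<open>\<phi> ^ h\<close>; if \<open>M\<close> exceeds the degree bound imposed by the size, such an
  element has all its coefficients in \<open>I ^ (n - h)\<close>, and these are small.\<close>

lemma separated_ring_adjoin_transcendental:
  fixes t :: "'a :: field_char_0"
  assumes "separated_ring R N" and t: "\<And>p. p \<in> polys R \<Longrightarrow> poly p t = 0 \<Longrightarrow> p = 0"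
  shows "separated_ring (adjoin R t) (adjoin_size N 2 (polys R) t)"
proof -
  interpret separated_ring R N by fact
  interpret polys: subring_ideal "polys R" "polys R"
    by (intro subring_ideal.subring_ideal_polys subring_ideal_self)
  have inj: "inj_on (\<lambda>p. poly p t) (polys R)"
    using t[OF polys.diff_mem] by (force intro!: inj_onI)
  let ?N = "adjoin_size N 2 (polys R) t"
  interpret A: sized_ring "adjoin R t" ?N
    by (rule sized_ring_adjoin) (auto intro: polys.mems inj)
  show ?thesis
  proof
    fix \<rho> :: 'a and S :: nat assume "\<rho> \<in> adjoin R t" "\<rho> \<noteq> 0"
    then obtain p where p: "p \<in> polys R" "\<rho> = poly p t" "p \<noteq> 0"
      unfolding adjoin_def by (metis imageE poly_0)
    \<comment> \<open>With \<open>h = n div 2\<close> and n at least 2 one has n \<le> 3 * h, so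
      this M makes \<open>S * n < M * h\<close>: the degree bound falls below the degree of \<phi> ^
      h.\<close>
    define M where "M = 3 * S + 1"
    have "finite ((of_nat :: nat \<Rightarrow> 'a) -` {x. poly p x = 0})"
      using poly_roots_finite[OF p(3)] by (intro finite_vimageI) (auto intro: inj_of_nat)
    then have "infinite {u :: nat. poly p (of_nat u) \<noteq> 0}"
      using finite_Collect_not[of "\<lambda>u. poly p (of_nat u :: 'a) = 0"] by (simp add: vimage_def)
    then obtain U where U: "finite U" "card U = M" "U \<subseteq> {u :: nat. poly p (of_nat u) \<noteq> 0}"
      using infinite_arbitrarily_large by metis
    \<comment> \<open>Making the product of the values invertible modulo I makes each value p(u)
      invertible.\<close>
    define \<nu> where "\<nu> = (\<Prod>u\<in>U. poly p (of_nat u))"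
    have pR: "poly p (of_nat u) \<in> R" for u
      using subring_ideal.poly_polys_mem[OF subring_ideal_self p(1) of_nat_mem] .
    have "\<nu> \<in> R" "\<nu> \<noteq> 0" unfolding \<nu>_def using U pR by (auto intro: prod_mem)
    \<comment> \<open>Coefficients will have size at most 2 ^ (S * n) but lie only in I ^ (n - h);
      as n \<le> 2 * (n - h), the base 2 ^ (2 * S) suffices.\<close>
    from separating[OF this, of "2 ^ (2 * S)"] obtain I \<sigma> n0 where I: "subring_ideal R I" "finite_index R I"
      and \<sigma>: "\<sigma> \<in> R" "\<nu> * \<sigma> - 1 \<in> I"
      and small: "\<And>n x. n \<ge> n0 \<Longrightarrow> x \<in> ideal_power R I n \<Longrightarrow> N x \<le> (2 ^ (2 * S)) ^ n \<Longrightarrow> x = 0"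
      by metis
    interpret subring_ideal R I by fact
    define \<phi> where "\<phi> = (\<Prod>u\<in>U. [:- of_nat u, 1 :: 'a:])"
    have \<phi>: "\<phi> \<in> polys R" unfolding \<phi>_def
      by (intro polys.prod_mem) (auto simp: polys_def coeff_pCons mems split: nat.split)
    have lead: "lead_coeff \<phi> = 1" unfolding \<phi>_def by (simp add: lead_coeff_prod)
    have deg: "degree \<phi> = M" unfolding \<phi>_def using U by (subst degree_prod_sum_eq) auto
    let ?J = "adjoin_ideal R I \<phi> t"
    have unit: "\<exists>\<tau>\<in>R. poly p (of_nat u) * \<tau> - 1 \<in> I" if "u \<in> U" for u
    proof
      have "\<nu> = poly p (of_nat u) * (\<Prod>u\<in>U-{u}. poly p (of_nat u))"
        unfolding \<nu>_def using U that by (simp add: prod.remove)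
      then show "poly p (of_nat u) * ((\<Prod>u\<in>U-{u}. poly p (of_nat u)) * \<sigma>) - 1 \<in> I"
        using \<sigma> by (simp add: mult.assoc)
      show "(\<Prod>u\<in>U-{u}. poly p (of_nat u)) * \<sigma> \<in> R" using pR \<sigma> by (intro mult_mem prod_mem)
    qed
    have "\<exists>\<sigma>\<in>adjoin R t. \<rho> * \<sigma> - 1 \<in> ?J"
    proof -
      obtain a e q where a: "a \<in> polys R" "e \<in> polys I" "q \<in> polys R" "p * a - 1 = e + \<phi> * q"
        using unit_mod_adjoin_ideal[OF p(1) U(1) unit] unfolding \<phi>_def by blast
      have "\<rho> * poly a t - 1 = poly (p * a - 1) t" by (simp add: p)
      then have "\<rho> * poly a t - 1 \<in> ?J" using a by (auto intro: adjoin_idealI)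
      then show ?thesis using a(1) by (auto intro: adjoinI)
    qed
    moreover have "x = 0" if n: "n \<ge> 2 * n0 + 2" and x: "x \<in> ideal_power (adjoin R t) ?J n" "?N x \<le> S ^ n" for n x
    proof (rule ccontr)
      assume "x \<noteq> 0"
      define h where "h = n div 2"
      obtain e q where eq: "e \<in> polys (ideal_power R I (n - h))" "q \<in> polys R" "x = poly (e + \<phi> ^ h * q) t"
        using adjoin_ideal_power_cases[OF \<phi> x(1), of h] by (auto simp: h_def)
      define f where "f = \<phi> ^ h * q + e"
      interpret L: subring_ideal R "ideal_power R I (n - h)" by (rule subring_ideal_power)
      have "e \<in> polys R" using eq(1) by (rule L.polys_ideal_sub)
      then have fR: "f \<in> polys R" unfolding f_def
        using eq \<phi> by (intro polys.add_mem polys.mult_mem polys.power_mem)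
      have xf: "x = poly f t" using eq by (simp add: f_def)
      then have f0: "f \<noteq> 0" using \<open>x \<noteq> 0\<close> by auto
      have size: "poly_size N 2 f \<le> S ^ n"
        using x(2) adjoin_size_poly[OF inj fR] by (simp add: xf)
      have S: "S ^ n \<le> 2 ^ (S * n)"
        unfolding power_mult by (intro power_mono) (auto intro: less_imp_le less_exp)
      \<comment> \<open>A nonzero leading coefficient has size at least 1, so the weight 2 converts
        the size bound into \<open>degree f \<le> S * n\<close>.\<close>
      have "1 * 2 ^ degree f \<le> N (lead_coeff f) * 2 ^ degree f"
        using size_eq_0[OF polys_coeff[OF fR, of "degree f"]] f0
        by (intro mult_right_mono) (auto simp: Suc_le_eq simp flip: neq0_conv)
      also have "\<dots> \<le> 2 ^ (S * n)"
        using poly_size_coeff_le[of 2 f "degree f"] size S by linarith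
      finally have "degree f \<le> S * n" by simp
      also have "\<dots> < M * h"
      proof -
        have "n \<le> 3 * h" "h \<ge> 1" using n unfolding h_def by linarith+
        then have "S * n \<le> S * (3 * h)" by (intro mult_left_mono) auto
        then have "S * n < S * (3 * h) + h" using \<open>h \<ge> 1\<close> by linarith
        then show ?thesis by (simp add: M_def algebra_simps)
      qed
      also have "\<dots> = degree (\<phi> ^ h)" using lead by (subst degree_power_eq) (auto simp: deg)
      finally have "f \<in> polys (ideal_power R I (n - h))" unfolding f_def
        by (intro L.polys_reduce_monic) (use \<phi> eq lead in \<open>auto simp: lead_coeff_power intro: polys.power_mem\<close>)
      moreover have "N (coeff f i) \<le> (2 ^ (2 * S)) ^ (n - h)" for i
      proof -
        have "N (coeff f i) \<le> 2 ^ (S * n)"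
          using poly_size_coeff_le'[of 2 f i] size S by linarith
        also have "\<dots> \<le> 2 ^ (S * (2 * (n - h)))"
          by (intro power_increasing mult_left_mono) (auto simp: h_def)
        finally show ?thesis by (simp add: power_mult [symmetric] mult_ac)
      qed
      moreover have "n - h \<ge> n0" using n by (simp add: h_def)
      ultimately have "coeff f i = 0" for i
        by (intro small) (auto simp: polys_def)
      then show False using f0 by (simp add: poly_eq_iff)
    qed
    moreover have "finite_index (adjoin R t) ?J"
      by (rule finite_index_adjoin) (use \<phi> lead deg I in \<open>auto simp: M_def\<close>)
    ultimately show "\<exists>J. subring_ideal (adjoin R t) J \<and> finite_index (adjoin R t) J \<and>
        (\<exists>\<sigma>\<in>adjoin R t. \<rho> * \<sigma> - 1 \<in> J) \<and>
        (\<exists>n0. \<forall>n\<ge>n0. \<forall>x\<in>ideal_power (adjoin R t) J n. ?N x \<le> S ^ n \<longrightarrow> x = 0)"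
      using subring_ideal_adjoin[OF \<phi>] by blast
  qed
qed

text \<open>Every nonzero \<rho> has a nonzero multiple in \<open>R\<close>, and an ideal of
  \<open>R\<close> separating for that multiple is extended to the new ring. Division by the monic m
  keeps coefficients in I ^ n, and uniqueness of normal forms transfers the size bound to
  them.\<close>

lemma separated_ring_adjoin_integral:
  fixes t :: "'a :: field_char_0"
  assumes "separated_ring R N" and m: "m \<in> polys R" "lead_coeff m = 1" "degree m \<ge> 1" "poly m t = 0"
    and min: "\<And>p. p \<in> polys R \<Longrightarrow> poly p t = 0 \<Longrightarrow> degree p < degree m \<Longrightarrow> p = 0"
  shows "\<exists>N'. separated_ring (adjoin R t) N'"
proof -
  interpret separated_ring R N by fact
  interpret self: subring_ideal R R by (rule subring_ideal_self)
  interpret polys: subring_ideal "polys R" "polys R" by (rule self.subring_ideal_polys)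
  let ?D = "degree m"
  \<comment> \<open>With this weight the lower part of m has size at most w ^ D, the size of the
    power of t that it replaces; so reduction never increases sizes.\<close>
  define w where "w = max 1 (\<Sum>i<?D. N (coeff m i))"
  define P where "P = {p \<in> polys R. degree p < ?D}"
  have inj: "inj_on (\<lambda>p. poly p t) P"
  proof (rule inj_onI)
    fix p q assume "p \<in> P" "q \<in> P" "poly p t = poly q t"
    then have "p - q = 0"
      by (intro min) (auto simp: P_def intro: polys.diff_mem degree_diff_less)
    then show "p = q" by simp
  qed
  define m' where "m' = m - monom 1 ?D"
  have m': "m' \<in> polys R" unfolding m'_def
    by (intro polys.diff_mem self.polys_monom m one_mem)
  have deg_m': "degree m' < ?D"
    by (rule degree_lessI) (use m(2,3) in \<open>auto simp: m'_def coeff_eq_0 le_less\<close>)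
  have size_m': "poly_size N w m' \<le> w ^ ?D"
  proof -
    have "poly_size N w m' = (\<Sum>i\<le>?D - 1. N (coeff m' i) * w ^ i)"
      using deg_m' by (intro poly_size_bound) auto
    also have "{..?D - 1} = {..<?D}" using m(3) by auto
    also have "(\<Sum>i<?D. N (coeff m' i) * w ^ i) \<le> (\<Sum>i<?D. N (coeff m i) * w ^ (?D - 1))"
      using m(3) by (intro sum_mono mult_mono power_increasing) (auto simp: m'_def w_def)
    also have "\<dots> \<le> w * w ^ (?D - 1)"
      unfolding sum_distrib_right[symmetric] by (intro mult_right_mono) (auto simp: w_def)
    also have "\<dots> = w ^ ?D" using m(3) by (cases ?D) auto
    finally show ?thesis .
  qed
  have red: "\<exists>q\<in>P. poly q t = poly p t \<and> poly_size N w q \<le> poly_size N w p" if "p \<in> polys R" for p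
    using that
  proof (induction "degree p" arbitrary: p rule: less_induct)
    case less
    show ?case
    proof (cases "degree p < ?D")
      case True
      then show ?thesis using less.prems by (intro bexI[of _ p]) (auto simp: P_def)
    next
      case False
      let ?n = "degree p" and ?l = "lead_coeff p"
      have l: "?l \<in> R" using less.prems by (rule polys_coeff)
      define u where "u = p - monom ?l ?n"
      define v where "v = monom ?l (?n - ?D) * m'"
      have uv: "u \<in> polys R" "v \<in> polys R" unfolding u_def v_def
        by (auto intro!: polys.diff_mem polys.mult_mem self.polys_monom less.prems l m')
      have "degree u < ?n" unfolding u_def
        by (rule degree_lessI) (use False m(3) in \<open>auto simp: coeff_eq_0 le_less\<close>)
      moreover have "degree v < ?n"
      proof -
        have "degree v \<le> degree (monom ?l (?n - ?D)) + degree m'" unfolding v_def by (rule degree_mult_le)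
        also have "\<dots> \<le> (?n - ?D) + degree m'" by (intro add_right_mono degree_monom_le)
        finally show ?thesis using deg_m' False by linarith
      qed
      ultimately have "degree (u - v) < ?n" by (rule degree_diff_less)
      from less.hyps[OF this polys.diff_mem[OF uv]] obtain q where
        q: "q \<in> P" "poly q t = poly (u - v) t" "poly_size N w q \<le> poly_size N w (u - v)" by blast
      have "p - (u - v) = monom ?l (?n - ?D) * m"
        using False by (simp add: u_def v_def m'_def right_diff_distrib mult_monom)
      then have "poly (p - (u - v)) t = 0" using m(4) by simp
      then have "poly q t = poly p t" using q(2) by simp
      moreover have "poly_size N w (u - v) \<le> poly_size N w p"
      proof -
        have "poly_size N w v \<le> N ?l * w ^ (?n - ?D) * poly_size N w m'"
          unfolding v_def by (rule poly_size_monom_mult[OF l m'])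
        also have "\<dots> \<le> N ?l * w ^ (?n - ?D) * w ^ ?D"
          by (intro mult_left_mono size_m') auto
        also have "\<dots> = N ?l * w ^ ?n" using False by (simp flip: power_add)
        finally have v: "poly_size N w v \<le> N ?l * w ^ ?n" .
        have "poly_size N w u = (\<Sum>i\<le>?n. N (coeff u i) * w ^ i)"
          using \<open>degree u < ?n\<close> by (intro poly_size_bound) simp
        also have "\<dots> = (\<Sum>i<?n. N (coeff u i) * w ^ i)"
          by (simp add: lessThan_Suc_atMost[symmetric] u_def size_zero)
        also have "\<dots> = (\<Sum>i<?n. N (coeff p i) * w ^ i)"
          by (intro sum.cong) (auto simp: u_def)
        finally have "poly_size N w u + N ?l * w ^ ?n = poly_size N w p"
          by (simp add: poly_size_def lessThan_Suc_atMost[symmetric])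
        then show ?thesis
          using v poly_size_add[OF uv(1) polys.uminus_mem[OF uv(2)], of w] poly_size_uminus[OF uv(2), of w]
          by simp
      qed
      ultimately show ?thesis using q by (intro bexI[of _ q]) auto
    qed
  qed
  let ?N = "adjoin_size N w P t"
  interpret A: sized_ring "adjoin R t" ?N
    by (rule sized_ring_adjoin[OF _ _ _ _ inj red])
      (use m(3) in \<open>auto simp: P_def w_def intro: polys.mems\<close>)
  \<comment> \<open>Descent on the degree: dividing m by p leaves a remainder whose value at t is a
    multiple of p(t).\<close>
  have multiple: "\<exists>\<sigma>\<in>adjoin R t. poly p t * \<sigma> \<in> R \<and> poly p t * \<sigma> \<noteq> 0" if "p \<in> P" "p \<noteq> 0" for p
    using that
  proof (induction "degree p" arbitrary: p rule: less_induct)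
    case less
    have p: "p \<in> polys R" "degree p < ?D" using less.prems by (auto simp: P_def)
    show ?case
    proof (cases "degree p = 0")
      case True
      then obtain c where c: "p = [:c:]" by (auto elim: degree_eq_zeroE)
      then show ?thesis using less.prems polys_coeff[OF p(1), of 0]
        by (intro bexI[of _ 1] A.one_mem) auto
    next
      case False
      then obtain k q r where qr: "smult (lead_coeff p ^ k) m = p * q + r" "q \<in> polys R" "r \<in> polys R"
        "degree r < degree p" using self.pseudo_division[OF p(1) _ m(1)] by (metis Suc_leI One_nat_def neq0_conv)
      have "poly (p * q + r) t = 0" using m(4) by (simp flip: qr(1))
      then have eq: "poly p t * poly (- q) t = poly r t" by (simp add: add_eq_0_iff)
      \<comment> \<open>Otherwise the cofactor q would be a nonzero polynomial of degree below
        \<open>degree m\<close> vanishing at t.\<close>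
      have "r \<noteq> 0"
      proof
        assume r: "r = 0"
        then have *: "smult (lead_coeff p ^ k) m = p * q" using qr(1) by simp
        have "poly p t \<noteq> 0" using min[OF p(1) _ p(2)] less.prems(2) by blast
        then have "poly q t = 0" using eq r by simp
        have "m \<noteq> 0" using m(3) by auto
        then have "q \<noteq> 0" using * less.prems(2) by auto
        then have "?D = degree p + degree q"
          using arg_cong[OF *, of degree] less.prems(2) by (simp add: degree_mult_eq)
        then show False using min[OF qr(2) \<open>poly q t = 0\<close>] False \<open>q \<noteq> 0\<close> by auto
      qed
      moreover have "r \<in> P" using qr p by (simp add: P_def)
      ultimately obtain \<sigma> where "\<sigma> \<in> adjoin R t" "poly r t * \<sigma> \<in> R" "poly r t * \<sigma> \<noteq> 0"
        using less.hyps[OF qr(4)] by blast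
      then show ?thesis unfolding eq[symmetric]
        by (intro bexI[of _ "poly (- q) t * \<sigma>"])
          (auto simp: mult.assoc intro!: A.mult_mem adjoinI polys.uminus_mem qr simp del: poly_minus)
    qed
  qed
  have "separated_ring (adjoin R t) ?N"
  proof
    fix \<rho> :: 'a and S :: nat assume \<rho>: "\<rho> \<in> adjoin R t" "\<rho> \<noteq> 0"
    then obtain p where "p \<in> P" "\<rho> = poly p t" using red unfolding adjoin_def by (metis imageE)
    then obtain \<sigma>1 where \<sigma>1: "\<sigma>1 \<in> adjoin R t" "\<rho> * \<sigma>1 \<in> R" "\<rho> * \<sigma>1 \<noteq> 0"
      using multiple \<rho>(2) by force
    from separating[OF \<sigma>1(2,3), of S] obtain I \<sigma> n0 where I: "subring_ideal R I" "finite_index R I"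
      and \<sigma>: "\<sigma> \<in> R" "\<rho> * \<sigma>1 * \<sigma> - 1 \<in> I"
      and small: "\<And>n x. n \<ge> n0 \<Longrightarrow> x \<in> ideal_power R I n \<Longrightarrow> N x \<le> S ^ n \<Longrightarrow> x = 0"
      by metis
    interpret subring_ideal R I by fact
    let ?J = "adjoin_ideal R I m t"
    have "\<rho> * (\<sigma>1 * \<sigma>) - 1 \<in> ?J"
      by (rule adjoin_idealI[OF polys_const[OF \<sigma>(2)] polys.zero_mem]) (simp add: mult.assoc)
    moreover have "\<sigma>1 * \<sigma> \<in> adjoin R t" by (intro A.mult_mem \<sigma>1 subset_adjoin \<sigma>)
    moreover have "x = 0" if n: "n \<ge> n0" and x: "x \<in> ideal_power (adjoin R t) ?J n" "?N x \<le> S ^ n" for n x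
    proof -
      obtain e where e: "e \<in> polys (ideal_power R I n)" "x = poly e t"
        using adjoin_ideal_power_cases_root[OF m(1,4) x(1)] by blast
      interpret L: subring_ideal R "ideal_power R I n" by (rule subring_ideal_power)
      obtain k q r where qr: "smult (lead_coeff m ^ k) e = m * q + r" "q \<in> polys (ideal_power R I n)"
        "r \<in> polys (ideal_power R I n)" "degree r < ?D"
        by (rule L.pseudo_division[OF m(1,3) e(1)])
      have "poly (smult (lead_coeff m ^ k) e) t = poly r t" using m(4) by (simp add: qr(1))
      then have xr: "x = poly r t" using e m(2) by simp
      have "r \<in> P" using L.polys_ideal_sub qr by (simp add: P_def)
      then have "poly_size N w r \<le> S ^ n" using x(2) adjoin_size_poly[OF inj, of r] by (simp add: xr)
      then have "N (coeff r i) \<le> S ^ n" for i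
        using poly_size_coeff_le'[of w r i] by (simp add: w_def)
      then have "coeff r i = 0" for i using qr(3) n by (intro small) (auto simp: polys_def)
      then have "r = 0" by (simp add: poly_eq_iff)
      then show "x = 0" by (simp add: xr)
    qed
    moreover have "finite_index (adjoin R t) ?J"
      by (rule finite_index_adjoin) (use m I in auto)
    ultimately show "\<exists>J. subring_ideal (adjoin R t) J \<and> finite_index (adjoin R t) J \<and>
        (\<exists>\<sigma>\<in>adjoin R t. \<rho> * \<sigma> - 1 \<in> J) \<and>
        (\<exists>n0. \<forall>n\<ge>n0. \<forall>x\<in>ideal_power (adjoin R t) J n. ?N x \<le> S ^ n \<longrightarrow> x = 0)"
      using subring_ideal_adjoin[OF m(1)] by blast
  qed
  then show ?thesis by blast
qed

text \<open>For p of least degree D with leading coefficient l, the polynomial l ^ (D - 1) p(X / l)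
  is monic over \<open>R\<close> and kills l c. A relation q for l c gives the relation q(l X) of
  the same degree for c, so minimality carries over.\<close>

lemma (in subring) algebraic_multiple_integral:
  assumes "p \<in> polys R" "p \<noteq> 0" "poly p c = 0"
  obtains l m where "l \<in> R" "l \<noteq> 0" "m \<in> polys R" "lead_coeff m = 1" "degree m \<ge> 1" "poly m (l * c) = 0"
    "\<And>q. q \<in> polys R \<Longrightarrow> poly q (l * c) = 0 \<Longrightarrow> degree q < degree m \<Longrightarrow> q = 0"
proof -
  from ex_has_least_nat[of "\<lambda>p. p \<in> polys R \<and> p \<noteq> 0 \<and> poly p c = 0" p degree] assms
  obtain p where p: "p \<in> polys R" "p \<noteq> 0" "poly p c = 0"
    and min: "\<And>q. q \<in> polys R \<Longrightarrow> q \<noteq> 0 \<Longrightarrow> poly q c = 0 \<Longrightarrow> degree p \<le> degree q"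
    by blast
  define D where "D = degree p"
  define l where "l = lead_coeff p"
  have D: "D \<ge> 1"
  proof (rule ccontr)
    assume "\<not> D \<ge> 1"
    then have "degree p = 0" unfolding D_def by simp
    then obtain a where "p = [:a:]" by (auto elim: degree_eq_zeroE)
    then show False using p by simp
  qed
  have l: "l \<in> R" "l \<noteq> 0" using p polys_coeff[OF p(1)] by (auto simp: l_def)
  define f where "f = (\<Sum>i<D. monom (coeff p i * l ^ (D - 1 - i)) i)"
  define m where "m = monom 1 D + f"
  have f: "coeff f i = (if i < D then coeff p i * l ^ (D - 1 - i) else 0)" for i
    by (simp add: f_def coeff_sum coeff_monom)
  have "degree f < D"
    using D by (intro degree_lessI) (auto simp: f)
  then have deg: "degree m = D" unfolding m_def
    by (subst degree_add_eq_left) (auto simp: degree_monom_eq)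
  show thesis
  proof (rule that[OF l])
    show "m \<in> polys R" using p(1) l
      by (auto simp: polys_def m_def f coeff_monom intro!: add_mem mult_mem power_mem zero_mem one_mem)
    show "lead_coeff m = 1" by (simp add: deg) (simp add: m_def f)
    show "degree m \<ge> 1" using D deg by simp
    have "poly m (l * c) = (l * c) ^ D + (\<Sum>i<D. coeff p i * l ^ (D - 1 - i) * (l * c) ^ i)"
      by (simp add: m_def f_def poly_sum poly_monom)
    also have "(l * c) ^ D = l ^ (D - 1) * (l * c ^ D)"
      using D by (cases D) (auto simp: power_mult_distrib)
    also have "(\<Sum>i<D. coeff p i * l ^ (D - 1 - i) * (l * c) ^ i) = (\<Sum>i<D. l ^ (D - 1) * (coeff p i * c ^ i))"
    proof (rule sum.cong)
      fix i assume "i \<in> {..<D}"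
      then have "l ^ (D - 1) = l ^ (D - 1 - i) * l ^ i" by (simp flip: power_add)
      then show "coeff p i * l ^ (D - 1 - i) * (l * c) ^ i = l ^ (D - 1) * (coeff p i * c ^ i)"
        by (simp add: power_mult_distrib mult_ac)
    qed simp
    also have "l ^ (D - 1) * (l * c ^ D) + (\<Sum>i<D. l ^ (D - 1) * (coeff p i * c ^ i)) = l ^ (D - 1) * poly p c"
      by (simp add: poly_altdef D_def[symmetric] lessThan_Suc_atMost[symmetric] l_def sum_distrib_left distrib_left)
    finally show "poly m (l * c) = 0" using p(3) by simp
  next
    fix q assume q: "q \<in> polys R" "poly q (l * c) = 0" "degree q < degree m"
    define q' where "q' = pcompose q [:0, l:]"
    have "coeff q' i = l ^ i * coeff q i" for i
      unfolding q'_def by (rule coeff_pcompose_linear)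
    then have "q' \<in> polys R" using q(1) l by (auto simp: polys_def intro: mult_mem power_mem)
    moreover have "poly q' c = 0" using q(2) by (simp add: q'_def poly_pcompose mult.commute)
    moreover have "degree q' = degree q" using l by (simp add: q'_def degree_pcompose)
    ultimately have "q' = 0" using min[of q'] q(3) deg by (auto simp: D_def)
    then show "q = 0" using l by (simp add: q'_def pcompose_eq_0)
  qed
qed

text \<open>The constants are adjoined one by one: a transcendental one as it is, an algebraic one
  after multiplication by an l that makes it integral. The common denominator r collects these
  factors.\<close>

theorem separated_ring_exists:
  fixes C :: "'a :: field_char_0 set"
  assumes "finite C"
  obtains R N r where "separated_ring R N" "r \<in> R" "r \<noteq> 0" "\<And>c. c \<in> C \<Longrightarrow> r * c \<in> R"
proof -
  have "\<exists>R N. separated_ring R N \<and> (\<exists>r\<in>R. r \<noteq> 0 \<and> (\<forall>c\<in>C. r * c \<in> R))"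
    using assms
  proof (induction C)
    case empty
    show ?case using separated_ring_Ints[where 'a = 'a] by (metis Ints_1 empty_iff zero_neq_one)
  next
    case (insert c C)
    then obtain R N r where R: "separated_ring R N" and r: "r \<in> R" "r \<noteq> 0" "\<And>c. c \<in> C \<Longrightarrow> r * c \<in> R"
      by blast
    interpret separated_ring R N by fact
    show ?case
    proof (cases "\<forall>p\<in>polys R. poly p c = 0 \<longrightarrow> p = 0")
      case True
      interpret A: subring "adjoin R c" by (rule subring_adjoin)
      have "\<forall>d\<in>insert c C. r * d \<in> adjoin R c"
        using r by (auto intro: A.mult_mem subset_adjoin generator_in_adjoin)
      then show ?thesis
        using separated_ring_adjoin_transcendental[OF R] True r subset_adjoin by blast
    next
      case False
      then obtain p where p: "p \<in> polys R" "p \<noteq> 0" "poly p c = 0" by blast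
      obtain l m where l: "l \<in> R" "l \<noteq> 0" and m: "m \<in> polys R" "lead_coeff m = 1" "degree m \<ge> 1" "poly m (l * c) = 0"
        "\<And>q. q \<in> polys R \<Longrightarrow> poly q (l * c) = 0 \<Longrightarrow> degree q < degree m \<Longrightarrow> q = 0"
        using algebraic_multiple_integral[OF p] by metis
      interpret A: subring "adjoin R (l * c)" by (rule subring_adjoin)
      have "(r * l) * d \<in> adjoin R (l * c)" if "d \<in> insert c C" for d
      proof (cases "d = c")
        case True
        then show ?thesis
          using A.mult_mem[OF subset_adjoin[OF r(1)] generator_in_adjoin[of "l * c"]] by (simp add: mult.assoc)
      next
        case False
        then have "l * (r * d) \<in> R" using that l r by (auto intro: mult_mem)
        then show ?thesis using subset_adjoin by (simp add: mult_ac)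
      qed
      moreover have "r * l \<in> adjoin R (l * c)" "r * l \<noteq> 0" using r l by (auto intro: subset_adjoin mult_mem)
      ultimately show ?thesis using separated_ring_adjoin_integral[OF R m] by blast
    qed
  qed
  then show thesis using that by blast
qed

section \<open>Heights of points on the projective line\<close>

definition form :: "nat \<Rightarrow> (nat \<Rightarrow> 'a :: comm_ring_1) \<Rightarrow> 'a \<Rightarrow> 'a \<Rightarrow> 'a" where
  "form d c a b = (\<Sum>l\<le>d. c l * a ^ l * b ^ (d - l))"

lemma (in subring) form_mem:
  "(\<And>l. c l \<in> R) \<Longrightarrow> a \<in> R \<Longrightarrow> b \<in> R \<Longrightarrow> form d c a b \<in> R"
  unfolding form_def by (intro sum_mem mult_mem power_mem)

context sized_ring
begin

text \<open>The monomials have degree n - 1. With this shift, pulling back by a map of degree d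
  replaces n by exactly d * n, because d * (n - 1) + (d - 1) = d * n - 1. The free scalar \<nu>
  absorbs changes of homogeneous coordinates.\<close>

definition powers_bounded :: "nat \<Rightarrow> 'a \<Rightarrow> 'a \<Rightarrow> nat \<Rightarrow> bool" where
  "powers_bounded n a b T \<longleftrightarrow> (\<exists>\<nu>. \<nu> \<noteq> 0 \<and>
     (\<forall>i j. i + j + 1 = n \<longrightarrow> \<nu> * a ^ i * b ^ j \<in> R \<and> N (\<nu> * a ^ i * b ^ j) \<le> T))"

lemma powers_bounded_mono:
  "powers_bounded n a b T \<Longrightarrow> T \<le> T' \<Longrightarrow> powers_bounded n a b T'"
  unfolding powers_bounded_def by (meson le_trans)

lemma powers_bounded_scale:
  assumes "powers_bounded n (\<mu> * a) (\<mu> * b) T" "\<mu> \<noteq> 0"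
  shows "powers_bounded n a b T"
proof -
  from assms(1) obtain \<nu> where \<nu>: "\<nu> \<noteq> 0"
    "\<And>i j. i + j + 1 = n \<Longrightarrow> \<nu> * (\<mu> * a) ^ i * (\<mu> * b) ^ j \<in> R \<and> N (\<nu> * (\<mu> * a) ^ i * (\<mu> * b) ^ j) \<le> T"
    unfolding powers_bounded_def by blast
  have "\<nu> * (\<mu> * a) ^ i * (\<mu> * b) ^ j = \<nu> * \<mu> ^ (n - 1) * a ^ i * b ^ j" if "i + j + 1 = n" for i j
  proof -
    from that have "n - 1 = i + j" by simp
    then show ?thesis by (simp add: power_mult_distrib power_add mult_ac)
  qed
  with \<nu> assms(2) show ?thesis unfolding powers_bounded_def
    by (intro exI[of _ "\<nu> * \<mu> ^ (n - 1)"]) (metis mult_eq_0_iff power_not_zero)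
qed

text \<open>Expanding the form spends d degrees of the available monomials and costs only the sizes
  of its coefficients.\<close>

lemma form_mult_bound:
  assumes c: "\<And>l. c l \<in> R" and ij: "i + j = n"
    and y: "\<And>i j. i + j = n + d \<Longrightarrow> y * a ^ i * b ^ j \<in> R \<and> N (y * a ^ i * b ^ j) \<le> T"
  shows "y * form d c a b * a ^ i * b ^ j \<in> R \<and> N (y * form d c a b * a ^ i * b ^ j) \<le> (\<Sum>l\<le>d. N (c l)) * T"
proof -
  have eq: "y * form d c a b * a ^ i * b ^ j = (\<Sum>l\<le>d. c l * (y * a ^ (i + l) * b ^ (j + (d - l))))"
    unfolding form_def sum_distrib_left sum_distrib_right power_add by (simp only: mult_ac)
  have y': "y * a ^ (i + l) * b ^ (j + (d - l)) \<in> R \<and> N (y * a ^ (i + l) * b ^ (j + (d - l))) \<le> T"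
    if "l \<le> d" for l by (rule y) (use that ij in auto)
  have "N (\<Sum>l\<le>d. c l * (y * a ^ (i + l) * b ^ (j + (d - l)))) \<le>
      (\<Sum>l\<le>d. N (c l * (y * a ^ (i + l) * b ^ (j + (d - l)))))"
    by (intro size_sum mult_mem[OF c]) (use y' in auto)
  also have "\<dots> \<le> (\<Sum>l\<le>d. N (c l) * T)"
  proof (rule sum_mono)
    fix l assume "l \<in> {..d}"
    then show "N (c l * (y * a ^ (i + l) * b ^ (j + (d - l)))) \<le> N (c l) * T"
      using y'[of l] size_mult[OF c[of l], of "y * a ^ (i + l) * b ^ (j + (d - l))"]
      by (meson atMost_iff le_trans mult_le_mono2)
  qed
  finally show ?thesis unfolding eq sum_distrib_right
    using y' by (auto intro!: sum_mem mult_mem[OF c])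
qed

text \<open>The m factors P or Q are expanded one at a time, each spending e degrees in a and b and
  costing at most C; the scalar \<nu> is unchanged.\<close>

lemma powers_bounded_form_image:
  assumes P: "\<And>l. P l \<in> R" and Q: "\<And>l. Q l \<in> R"
    and C: "C = (\<Sum>l\<le>e. N (P l)) + (\<Sum>l\<le>e. N (Q l))"
    and bd: "powers_bounded (e * m + 1) a b T"
  shows "powers_bounded (m + 1) (form e P a b) (form e Q a b) (C ^ m * T)"
proof -
  from bd obtain \<nu> where \<nu>: "\<nu> \<noteq> 0"
    "\<And>i j. i + j + 1 = e * m + 1 \<Longrightarrow> \<nu> * a ^ i * b ^ j \<in> R \<and> N (\<nu> * a ^ i * b ^ j) \<le> T"
    unfolding powers_bounded_def by blast
  let ?P = "form e P a b" and ?Q = "form e Q a b"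
  have *: "\<nu> * ?P ^ i * ?Q ^ j * a ^ k * b ^ l \<in> R \<and> N (\<nu> * ?P ^ i * ?Q ^ j * a ^ k * b ^ l) \<le> C ^ s * T"
    if "s \<le> m" "i + j = s" "k + l = e * (m - s)" for s i j k l
    using that
  proof (induction s arbitrary: i j k l)
    case 0
    then show ?case using \<nu>(2)[of k l] by simp
  next
    case (Suc s)
    have em: "e * (m - s) = e * (m - Suc s) + e"
      using Suc.prems(1) by (metis Suc_diff_Suc Suc_le_eq add.commute mult_Suc_right)
    show ?case
    proof (cases i)
      case (Suc i')
      have A: "\<nu> * ?P ^ i' * ?Q ^ j * ?P * a ^ k * b ^ l \<in> R \<and>
          N (\<nu> * ?P ^ i' * ?Q ^ j * ?P * a ^ k * b ^ l) \<le> (\<Sum>l\<le>e. N (P l)) * (C ^ s * T)"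
        by (rule form_mult_bound[OF P Suc.prems(3)], rule Suc.IH) (use Suc Suc.prems em in auto)
      have B: "(\<Sum>l\<le>e. N (P l)) * (C ^ s * T) \<le> C ^ Suc s * T"
        unfolding C power_Suc mult.assoc by (intro mult_right_mono) auto
      have eq: "\<nu> * ?P ^ i' * ?Q ^ j * ?P * a ^ k * b ^ l = \<nu> * ?P ^ i * ?Q ^ j * a ^ k * b ^ l"
        by (simp add: Suc mult_ac)
      show ?thesis unfolding eq[symmetric] using A B by (blast intro: le_trans)
    next
      case 0
      then have j: "j = Suc s" using Suc.prems by simp
      have A: "\<nu> * ?P ^ i * ?Q ^ s * ?Q * a ^ k * b ^ l \<in> R \<and>
          N (\<nu> * ?P ^ i * ?Q ^ s * ?Q * a ^ k * b ^ l) \<le> (\<Sum>l\<le>e. N (Q l)) * (C ^ s * T)"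
        by (rule form_mult_bound[OF Q Suc.prems(3)], rule Suc.IH) (use 0 Suc.prems em in auto)
      have B: "(\<Sum>l\<le>e. N (Q l)) * (C ^ s * T) \<le> C ^ Suc s * T"
        unfolding C power_Suc mult.assoc by (intro mult_right_mono) auto
      have eq: "\<nu> * ?P ^ i * ?Q ^ s * ?Q * a ^ k * b ^ l = \<nu> * ?P ^ i * ?Q ^ j * a ^ k * b ^ l"
        by (simp add: j mult_ac)
      show ?thesis unfolding eq[symmetric] using A B by (blast intro: le_trans)
    qed
  qed
  show ?thesis unfolding powers_bounded_def
    using *[of m _ _ 0 0] \<nu>(1) by (intro exI[of _ \<nu>]) auto
qed

text \<open>The factor \<open>d\<close> is sharp although the size is only submultiplicative, because the factor \<open>c\<close>,
  the only one depending on the point, is independent of \<open>n\<close> and disappears in the growth rate.\<close>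

lemma powers_bounded_form_preimage:
  assumes d: "d \<ge> 1" and coeffs: "\<And>i l. \<alpha> i l \<in> R" "\<And>i l. \<beta> i l \<in> R" "a \<in> R" "b \<in> R"
    and \<kappa>: "\<kappa> \<noteq> 0"
    and bezout: "\<And>i j. i + j = 2 * d - 1 \<Longrightarrow>
       \<kappa> * a ^ i * b ^ j = form (d - 1) (\<alpha> i) a b * form d P a b + form (d - 1) (\<beta> i) a b * form d Q a b"
    and C: "C = (\<Sum>i\<le>2 * d - 1. \<Sum>l\<le>d - 1. N (\<alpha> i l) + N (\<beta> i l)) + 1"
    and c: "c = (\<Sum>i\<le>d - 1. N (a ^ i * b ^ (d - 1 - i)))"
    and bd: "powers_bounded n (form d P a b) (form d Q a b) T" and n: "n \<ge> 1"
  shows "powers_bounded (d * n) a b (c * C ^ n * T)"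
proof -
  define m where "m = n - 1"
  let ?P = "form d P a b" and ?Q = "form d Q a b"
  from bd obtain \<nu> where \<nu>: "\<nu> \<noteq> 0"
    "\<And>i j. i + j = m \<Longrightarrow> \<nu> * ?P ^ i * ?Q ^ j \<in> R \<and> N (\<nu> * ?P ^ i * ?Q ^ j) \<le> T"
    unfolding powers_bounded_def m_def using n by auto
  have C1: "(\<Sum>l\<le>d - 1. N (\<alpha> i l)) + (\<Sum>l\<le>d - 1. N (\<beta> i l)) \<le> C" if "i \<le> 2 * d - 1" for i
    using member_le_sum[of i "{..2 * d - 1}" "\<lambda>i. \<Sum>l\<le>d - 1. N (\<alpha> i l) + N (\<beta> i l)"] that
    by (simp add: C sum.distrib)
  \<comment> \<open>Each use of the Bezout identity turns 2 * d - 1 degrees in a and b into a form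
    of degree d - 1 times P or Q, a net loss of d. At s = 0 a single monomial of degree d - 1
    remains, which c bounds.\<close>
  have *: "\<kappa> ^ s * \<nu> * ?P ^ k * ?Q ^ l * a ^ i * b ^ j \<in> R \<and>
      N (\<kappa> ^ s * \<nu> * ?P ^ k * ?Q ^ l * a ^ i * b ^ j) \<le> c * C ^ s * T"
    if "s \<le> m" "k + l = m - s" "i + j = d * s + (d - 1)" for s k l i j
    using that
  proof (induction s arbitrary: i j k l)
    case 0
    let ?x = "\<nu> * ?P ^ k * ?Q ^ l" and ?y = "a ^ i * b ^ j"
    have x: "?x \<in> R" "N ?x \<le> T" using \<nu>(2)[of k l] 0 by auto
    have y: "?y \<in> R" using coeffs by (auto intro!: mult_mem power_mem)
    have "j = d - 1 - i" "i \<le> d - 1" using 0 by auto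
    then have "N ?y \<le> c" unfolding c
      using member_le_sum[of i "{..d - 1}" "\<lambda>i. N (a ^ i * b ^ (d - 1 - i))"] by simp
    then have "N ?x * N ?y \<le> T * c" using x by (intro mult_mono) auto
    then have "N (?x * ?y) \<le> T * c" using size_mult[OF x(1) y] by linarith
    moreover have "?x * ?y \<in> R" using x y by (rule_tac mult_mem)
    ultimately show ?case by (simp add: mult_ac)
  next
    case (Suc s)
    \<comment> \<open>Splits off a monomial of degree exactly 2 * d - 1; the total degree d * (s +
      1) + (d - 1) is large enough for this.\<close>
    define i1 where "i1 = min i (2 * d - 1)"
    define j1 where "j1 = 2 * d - 1 - i1"
    have i1: "i1 \<le> i" "j1 \<le> j" "i1 + j1 = 2 * d - 1" "i1 \<le> 2 * d - 1"
      using Suc.prems(3) unfolding i1_def j1_def by auto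
    have ij: "(i - i1) + (j - j1) = d * s" using i1 Suc.prems(3) d by auto
    let ?y = "\<kappa> ^ s * \<nu> * ?P ^ Suc k * ?Q ^ l" and ?z = "\<kappa> ^ s * \<nu> * ?P ^ k * ?Q ^ Suc l"
    let ?A = "form (d - 1) (\<alpha> i1) a b" and ?B = "form (d - 1) (\<beta> i1) a b"
    let ?v = "?y * ?A * a ^ (i - i1) * b ^ (j - j1)" and ?w = "?z * ?B * a ^ (i - i1) * b ^ (j - j1)"
    have y: "?v \<in> R \<and> N ?v \<le> (\<Sum>l\<le>d - 1. N (\<alpha> i1 l)) * (c * C ^ s * T)"
      by (rule form_mult_bound[OF coeffs(1) ij], rule Suc.IH) (use Suc.prems in auto)
    have z: "?w \<in> R \<and> N ?w \<le> (\<Sum>l\<le>d - 1. N (\<beta> i1 l)) * (c * C ^ s * T)"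
      by (rule form_mult_bound[OF coeffs(2) ij], rule Suc.IH) (use Suc.prems in auto)
    have pw: "a ^ i = a ^ i1 * a ^ (i - i1)" "b ^ j = b ^ j1 * b ^ (j - j1)"
      using i1 by (simp_all flip: power_add)
    have "\<kappa> ^ Suc s * \<nu> * ?P ^ k * ?Q ^ l * a ^ i * b ^ j =
        \<kappa> ^ s * \<nu> * ?P ^ k * ?Q ^ l * (\<kappa> * a ^ i1 * b ^ j1) * a ^ (i - i1) * b ^ (j - j1)"
      unfolding pw power_Suc by (simp only: mult_ac)
    also have "\<dots> = ?v + ?w"
      unfolding bezout[OF i1(3)] by (simp add: algebra_simps)
    finally have eq: "\<kappa> ^ Suc s * \<nu> * ?P ^ k * ?Q ^ l * a ^ i * b ^ j = ?v + ?w" .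
    have "N (?v + ?w) \<le> N ?v + N ?w" using y z by (intro size_add) auto
    also have "\<dots> \<le> (\<Sum>l\<le>d - 1. N (\<alpha> i1 l)) * (c * C ^ s * T) + (\<Sum>l\<le>d - 1. N (\<beta> i1 l)) * (c * C ^ s * T)"
      using y z by (intro add_mono) auto
    also have "\<dots> \<le> C * (c * C ^ s * T)"
      unfolding distrib_right[symmetric] by (intro mult_right_mono C1 i1) auto
    also have "\<dots> = c * C ^ Suc s * T" by (simp add: mult_ac)
    finally show ?case unfolding eq using y z add_mem by blast
  qed
  have "c * C ^ m * T \<le> c * C ^ n * T"
    by (intro mult_right_mono mult_left_mono power_increasing) (auto simp: C m_def)
  moreover have "d * m + (d - 1) + 1 = d * n" using n d by (cases n) (auto simp: m_def)
  then have "powers_bounded (d * n) a b (c * C ^ m * T)"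
    unfolding powers_bounded_def using *[of m 0 0] \<nu>(1) \<kappa>
    by (intro exI[of _ "\<kappa> ^ m * \<nu>"]) auto
  ultimately show ?thesis by (rule powers_bounded_mono[rotated])
qed

end

section \<open>Elementary estimates for comparing the growth of iterates\<close>

lemma exponential_dominates:
  fixes d e s t :: nat
  assumes "e < d"
  shows "eventually (\<lambda>n. s * (n + 1) * e ^ n \<le> d ^ (n - t)) sequentially"
proof -
  have d: "d > 0" using assms by simp
  let ?x = "real e / real d"
  have x: "norm ?x < 1" using assms by simp
  have "(\<lambda>n. real n * ?x ^ n + ?x ^ n) \<longlonglongrightarrow> 0 + 0"
    by (intro tendsto_add powser_times_n_limit_0 LIMSEQ_power_zero x)
  then have "(\<lambda>n. real (s * d ^ t) * (real n * ?x ^ n + ?x ^ n)) \<longlonglongrightarrow> real (s * d ^ t) * (0 + 0)"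
    by (rule tendsto_mult_left)
  then have "eventually (\<lambda>n. real (s * d ^ t) * (real n * ?x ^ n + ?x ^ n) < 1) sequentially"
    by (rule order_tendstoD(2)) simp
  then show ?thesis
    using eventually_ge_at_top[of t]
  proof eventually_elim
    case (elim n)
    have "real (s * d ^ t * (n + 1) * e ^ n) = real (s * d ^ t) * (real n * ?x ^ n + ?x ^ n) * real d ^ n"
      using d by (simp add: power_divide field_simps)
    also have "\<dots> \<le> 1 * real d ^ n" using elim by (intro mult_right_mono) auto
    finally have "real (s * d ^ t * (n + 1) * e ^ n) \<le> real (d ^ n)" by simp
    then have "s * d ^ t * (n + 1) * e ^ n \<le> d ^ n" by (simp only: of_nat_le_iff)
    also have "\<dots> = d ^ (n - t) * d ^ t" using elim by (simp flip: power_add)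
    finally have "d ^ t * (s * (n + 1) * e ^ n) \<le> d ^ t * d ^ (n - t)" by (simp only: mult_ac)
    then show ?case using d by simp
  qed
qed

lemma iterate_bound_le:
  fixes K C e n :: nat
  assumes "K \<le> 2 ^ s" "C \<le> 2 ^ s"
  shows "(K * C ^ n) ^ (e ^ n) \<le> 2 ^ (s * (n + 1) * e ^ n)"
proof -
  have "K * C ^ n \<le> 2 ^ s * (2 ^ s) ^ n" using assms by (intro mult_mono power_mono) auto
  also have "\<dots> = 2 ^ (s * (n + 1))" by (simp flip: power_mult power_add add: algebra_simps)
  finally have "(K * C ^ n) ^ (e ^ n) \<le> (2 ^ (s * (n + 1))) ^ (e ^ n)" by (rule power_mono) simp
  then show ?thesis by (simp flip: power_mult)
qed

text \<open>Raise x a + y b = 1 modulo I to the power 2 * d - 1 and apply the Bezout identity to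
  every monomial; the unit \<kappa> can then be inverted. This is good reduction of the map modulo
  I.\<close>

lemma (in subring_ideal) unimodular_form_image:
  assumes d: "d \<ge> 1" and coeffs: "\<And>i l. \<alpha> i l \<in> R" "\<And>i l. \<beta> i l \<in> R" "a \<in> R" "b \<in> R" "\<kappa> \<in> R"
    and unit: "\<exists>\<sigma>\<in>R. \<kappa> * \<sigma> - 1 \<in> I"
    and bezout: "\<And>i j. i + j = 2 * d - 1 \<Longrightarrow>
       \<kappa> * a ^ i * b ^ j = form (d - 1) (\<alpha> i) a b * p + form (d - 1) (\<beta> i) a b * q"
    and ab: "\<exists>x\<in>R. \<exists>y\<in>R. 1 - (x * a + y * b) \<in> I"
  shows "\<exists>x\<in>R. \<exists>y\<in>R. 1 - (x * p + y * q) \<in> I"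
proof -
  from unit obtain \<sigma> where \<sigma>: "\<sigma> \<in> R" "\<kappa> * \<sigma> - 1 \<in> I" by blast
  from ab obtain x y where xy: "x \<in> R" "y \<in> R" "1 - (x * a + y * b) \<in> I" by blast
  define D where "D = 2 * d - 1"
  define u where "u = x * a + y * b"
  have u: "u \<in> R" "1 - u \<in> I" using xy coeffs by (auto simp: u_def intro: mult_mem add_mem)
  define X where "X = \<sigma> * (\<Sum>i\<le>D. of_nat (D choose i) * x ^ i * y ^ (D - i) * form (d - 1) (\<alpha> i) a b)"
  define Y where "Y = \<sigma> * (\<Sum>i\<le>D. of_nat (D choose i) * x ^ i * y ^ (D - i) * form (d - 1) (\<beta> i) a b)"
  have "\<kappa> * u ^ D = (\<Sum>i\<le>D. of_nat (D choose i) * x ^ i * y ^ (D - i) * (\<kappa> * a ^ i * b ^ (D - i)))"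
    unfolding u_def binomial_ring sum_distrib_left
    by (intro sum.cong refl) (simp add: power_mult_distrib mult_ac)
  also have "\<dots> = (\<Sum>i\<le>D. of_nat (D choose i) * x ^ i * y ^ (D - i) *
      (form (d - 1) (\<alpha> i) a b * p + form (d - 1) (\<beta> i) a b * q))"
    by (intro sum.cong refl arg_cong2[where f = "(*)"] bezout) (auto simp: D_def)
  also have "\<sigma> * \<dots> = X * p + Y * q"
    unfolding X_def Y_def
    by (simp add: sum_distrib_left sum_distrib_right sum.distrib[symmetric] algebra_simps)
  finally have "1 - (X * p + Y * q) = (1 - u ^ D) - u ^ D * (\<kappa> * \<sigma> - 1)"
    by (simp add: algebra_simps)
  moreover have "(1 - u ^ D) - u ^ D * (\<kappa> * \<sigma> - 1) \<in> I"
    by (intro ideal_diff ideal_mult one_minus_power_mem u power_mem \<sigma>)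
  moreover have "X \<in> R" "Y \<in> R" unfolding X_def Y_def
    using \<sigma> xy coeffs by (auto intro!: mult_mem sum_mem power_mem of_nat_mem form_mem)
  ultimately show ?thesis by metis
qed

text \<open>The gap principle replacing Northcott's theorem: \<open>\<nu> \<nu>' (a b' - a' b) ^ n\<close> is an element of
  \<open>I ^ n\<close> whose size grows at most geometrically.\<close>

lemma (in sized_ring) congruent_points_eq:
  assumes I: "subring_ideal R I"
    and mem: "a \<in> R" "b \<in> R" "a' \<in> R" "b' \<in> R"
    and small: "\<And>n x. n \<ge> n0 \<Longrightarrow> x \<in> ideal_power R I n \<Longrightarrow> N x \<le> (4 * S ^ 4) ^ n \<Longrightarrow> x = 0"
    and S: "S \<ge> 1"
    and unimod: "\<exists>x\<in>R. \<exists>y\<in>R. 1 - (x * a + y * b) \<in> I" "\<exists>x\<in>R. \<exists>y\<in>R. 1 - (x * a' + y * b') \<in> I"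
    and congruent: "a * b' - a' * b \<in> I"
    and D: "D \<ge> 1" "\<And>m. m \<ge> 1 \<Longrightarrow> powers_bounded (D * m) a b (c * S ^ (D * m))"
    and D': "D' \<ge> 1" "\<And>m. m \<ge> 1 \<Longrightarrow> powers_bounded (D' * m) a' b' (c' * S ^ (D' * m))"
  shows "a * b' = a' * b"
proof -
  interpret subring_ideal R I by fact
  \<comment> \<open>Large enough for n to exceed n0 and c * c'. Below, n + 1 is a multiple of both D
    and D', so both families of bounds apply to monomials of the same degree n.\<close>
  define m where "m = Suc (n0 + c * c' + 1)"
  define n where "n = D * D' * m - 1"
  have "1 * m \<le> D * D' * m" using D D' by (intro mult_right_mono) auto
  then have n: "n + 1 = D * D' * m" "n \<ge> n0" "n \<ge> c * c'" "n \<ge> 1" unfolding n_def m_def by auto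
  have "D' * m \<ge> 1" "D * m \<ge> 1" using D D' by (auto simp: m_def)
  from D(2)[OF this(1)] D'(2)[OF this(2)]
  have "powers_bounded (n + 1) a b (c * S ^ (n + 1))" "powers_bounded (n + 1) a' b' (c' * S ^ (n + 1))"
    by (simp_all only: n mult_ac)
  then obtain \<nu> \<nu>' where \<nu>: "\<nu> \<noteq> 0" "\<nu>' \<noteq> 0"
    "\<And>i j. i + j = n \<Longrightarrow> \<nu> * a ^ i * b ^ j \<in> R \<and> N (\<nu> * a ^ i * b ^ j) \<le> c * S ^ (n + 1)"
    "\<And>i j. i + j = n \<Longrightarrow> \<nu>' * a' ^ i * b' ^ j \<in> R \<and> N (\<nu>' * a' ^ i * b' ^ j) \<le> c' * S ^ (n + 1)"
    unfolding powers_bounded_def by auto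
  define E where "E = \<nu> * \<nu>' * (a * b' - a' * b) ^ n"
  \<comment> \<open>The terms of the binomial expansion of E, grouped so that each scalar meets a
    monomial of its own point.\<close>
  define g where "g i = (- 1) ^ (n - i) * ((\<nu> * a ^ i * b ^ (n - i)) * (\<nu>' * a' ^ (n - i) * b' ^ i))" for i
  have g: "g i \<in> R" "N (g i) \<le> (c * S ^ (n + 1)) * (c' * S ^ (n + 1))" if "i \<le> n" for i
  proof -
    let ?x = "\<nu> * a ^ i * b ^ (n - i)" and ?y = "\<nu>' * a' ^ (n - i) * b' ^ i"
    have *: "?x \<in> R" "?y \<in> R" "N ?x \<le> c * S ^ (n + 1)" "N ?y \<le> c' * S ^ (n + 1)"
      using \<nu>(3)[of i "n - i"] \<nu>(4)[of "n - i" i] that by auto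
    then have xy: "?x * ?y \<in> R" by (rule_tac mult_mem)
    have "g i = ?x * ?y \<or> g i = - (?x * ?y)"
      unfolding g_def by (cases "even (n - i)") auto
    then have "N (g i) = N (?x * ?y)" using size_uminus[OF xy] by auto
    also have "\<dots> \<le> N ?x * N ?y" using * by (intro size_mult)
    also have "\<dots> \<le> (c * S ^ (n + 1)) * (c' * S ^ (n + 1))" using * by (intro mult_mono) auto
    finally show "N (g i) \<le> (c * S ^ (n + 1)) * (c' * S ^ (n + 1))" .
    show "g i \<in> R" unfolding g_def by (intro mult_mem[OF _ xy] power_mem uminus_mem one_mem)
  qed
  have E: "E = (\<Sum>i\<le>n. of_nat (n choose i) * g i)"
  proof -
    have "E = \<nu> * \<nu>' * (a * b' + (- 1) * (a' * b)) ^ n" by (simp add: E_def)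
    also have "\<dots> = (\<Sum>i\<le>n. of_nat (n choose i) * g i)"
      unfolding binomial_ring sum_distrib_left g_def power_mult_distrib
      by (intro sum.cong refl) (simp only: mult_ac)
    finally show ?thesis .
  qed
  have ER: "E \<in> R" unfolding E by (intro sum_mem mult_mem of_nat_mem g) auto
  have "N E \<le> (\<Sum>i\<le>n. N (of_nat (n choose i) * g i))"
    unfolding E by (intro size_sum mult_mem of_nat_mem g) auto
  also have "\<dots> \<le> (\<Sum>i\<le>n. (n choose i) * ((c * S ^ (n + 1)) * (c' * S ^ (n + 1))))"
  proof (rule sum_mono)
    fix i assume "i \<in> {..n}"
    then have "N (of_nat (n choose i) * g i) \<le> N (of_nat (n choose i)) * N (g i)"
      using g by (intro size_mult of_nat_mem) auto
    also have "\<dots> \<le> (n choose i) * ((c * S ^ (n + 1)) * (c' * S ^ (n + 1)))"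
      using g \<open>i \<in> {..n}\<close> by (intro mult_mono size_of_nat) auto
    finally show "N (of_nat (n choose i) * g i) \<le> (n choose i) * ((c * S ^ (n + 1)) * (c' * S ^ (n + 1)))" .
  qed
  also have "\<dots> = 2 ^ n * (c * c') * S ^ (2 * (n + 1))"
    unfolding sum_distrib_right[symmetric] choose_row_sum mult_2[of "n + 1"] power_add[of S "n + 1" "n + 1"]
    by (simp only: mult_ac)
  \<comment> \<open>Origin of 4 * S ^ 4: one factor 2 comes from the binomial coefficients, one from
    c * c' \<le> 2 ^ n, and S ^ 4 from 2 * (n + 1) \<le> 4 * n.\<close>
  also have "\<dots> \<le> 2 ^ n * 2 ^ n * S ^ (4 * n)"
  proof (intro mult_mono)
    show "c * c' \<le> 2 ^ n" using n(3) less_exp[of n] by linarith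
    show "S ^ (2 * (n + 1)) \<le> S ^ (4 * n)" using n(4) S by (intro power_increasing) auto
  qed auto
  also have "\<dots> = (2 * 2 * S ^ 4) ^ n"
    by (simp only: power_mult power_mult_distrib)
  also have "\<dots> = (4 * S ^ 4) ^ n" by simp
  finally have NE: "N E \<le> (4 * S ^ 4) ^ n" .
  obtain x y where xy: "x \<in> R" "y \<in> R" "1 - (x * a + y * b) \<in> I" using unimod by blast
  obtain x' y' where xy': "x' \<in> R" "y' \<in> R" "1 - (x' * a' + y' * b') \<in> I" using unimod by blast
  define u where "u = x * a + y * b"
  define u' where "u' = x' * a' + y' * b'"
  have u: "u \<in> R" "u' \<in> R" using xy xy' mem by (auto simp: u_def u'_def intro: mult_mem add_mem)
  \<comment> \<open>The expanded power contains only monomials of degree n in v and w, exactly those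
    that the scalar brings into \<open>R\<close>.\<close>
  have cleared: "\<mu> * (r * v + s * w) ^ n \<in> R"
    if "r \<in> R" "s \<in> R" and "\<And>i j. i + j = n \<Longrightarrow> \<mu> * v ^ i * w ^ j \<in> R" for \<mu> r s v w
  proof -
    have "\<mu> * (r * v + s * w) ^ n =
        (\<Sum>i\<le>n. of_nat (n choose i) * (r ^ i * s ^ (n - i)) * (\<mu> * v ^ i * w ^ (n - i)))"
      unfolding binomial_ring sum_distrib_left power_mult_distrib
      by (intro sum.cong refl) (simp only: mult_ac)
    also have "\<dots> \<in> R"
      using that(1,2) by (intro sum_mem mult_mem[OF _ that(3)] mult_mem of_nat_mem power_mem) auto
    finally show ?thesis .
  qed
  have \<nu>u: "\<nu> * u ^ n \<in> R" "\<nu>' * u' ^ n \<in> R"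
    unfolding u_def u'_def using xy xy' \<nu>(3,4) by (auto intro!: cleared)
  have "(u * u') ^ n * E = ((\<nu> * u ^ n) * (\<nu>' * u' ^ n)) * (a * b' - a' * b) ^ n"
    unfolding E_def power_mult_distrib by (simp only: mult_ac)
  also have "\<dots> \<in> ideal_power R I n"
    by (intro subring_ideal.ideal_mult[OF subring_ideal_power] power_in_ideal_power congruent mult_mem \<nu>u)
  finally have "(u * u') ^ n * E \<in> ideal_power R I n" .
  moreover have "1 - (u * u') ^ n \<in> I"
  proof (rule one_minus_power_mem)
    have "1 - u * u' = (1 - u) + u * (1 - u')" by (simp add: algebra_simps)
    then show "1 - u * u' \<in> I"
      using xy(3) xy'(3) ideal_add[OF _ ideal_mult[OF u(1)]] unfolding u_def u'_def by metis
  qed (intro mult_mem u)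
  moreover have "(u * u') ^ n \<in> R" by (intro power_mem mult_mem u)
  ultimately have "E \<in> ideal_power R I n"
    using ideal_power_cancel_unit ER by blast
  with small[OF n(2) _ NE] have "E = 0" by blast
  then have "a * b' - a' * b = 0" using \<nu>(1,2) by (simp add: E_def)
  then show ?thesis by simp
qed

theorem (in separated_ring) orbit_coincidences:
  fixes P Q P' Q' :: "nat \<Rightarrow> 'a" and a b u v :: "nat \<Rightarrow> 'a"
  assumes de: "1 \<le> e" "e < d"
    and PQ: "\<And>l. P l \<in> R" "\<And>l. Q l \<in> R" "\<And>l. P' l \<in> R" "\<And>l. Q' l \<in> R"
    and \<kappa>: "\<kappa> \<in> R" "\<kappa> \<noteq> 0" and \<alpha>\<beta>: "\<And>i l. \<alpha> i l \<in> R" "\<And>i l. \<beta> i l \<in> R"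
    and bezout: "\<And>i j x y. i + j = 2 * d - 1 \<Longrightarrow>
       \<kappa> * x ^ i * y ^ j = form (d - 1) (\<alpha> i) x y * form d P x y + form (d - 1) (\<beta> i) x y * form d Q x y"
    and init: "a 0 \<in> R" "b 0 \<in> R" "u 0 \<in> R" "v 0 \<in> R" "a 0 \<noteq> 0 \<or> b 0 \<noteq> 0"
    and ab: "\<And>n. a (Suc n) = form d P (a n) (b n)" "\<And>n. b (Suc n) = form d Q (a n) (b n)"
    and uv: "\<And>n. u (Suc n) = form e P' (u n) (v n)" "\<And>n. v (Suc n) = form e Q' (u n) (v n)"
    and coincide: "infinite {n. \<exists>\<mu>. \<mu> \<noteq> 0 \<and> u n = \<mu> * a n \<and> v n = \<mu> * b n}"
  shows "\<exists>j k. j \<noteq> k \<and> a j * b k = a k * b j"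
proof -
  have mem: "a n \<in> R" "b n \<in> R" for n
    by (induction n) (auto simp: init ab intro!: form_mem PQ)
  define C where "C = (\<Sum>i\<le>2 * d - 1. \<Sum>l\<le>d - 1. N (\<alpha> i l) + N (\<beta> i l)) + 1"
  define C' where "C' = (\<Sum>l\<le>e. N (P' l)) + (\<Sum>l\<le>e. N (Q' l))"
  define K where "K = N (u 0) + N (v 0)"
  \<comment> \<open>c depends on j and k but not on M or T. The exponent is a coarse bound for the
    accumulated cost 1 + d + ... + d ^ (k - 1) per unit of M.\<close>
  have pull: "\<exists>c. \<forall>M T. M \<ge> 1 \<longrightarrow> powers_bounded M (a (j + k)) (b (j + k)) T \<longrightarrow>
      powers_bounded (d ^ k * M) (a j) (b j) (c * C ^ ((d ^ k - 1) * M) * T)" for j k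
  proof (induction k arbitrary: j)
    case 0
    show ?case by (intro exI[of _ 1]) simp
  next
    case (Suc k)
    from Suc.IH[of "Suc j"] obtain c where c: "\<And>M T. M \<ge> 1 \<Longrightarrow>
      powers_bounded M (a (Suc j + k)) (b (Suc j + k)) T \<Longrightarrow>
      powers_bounded (d ^ k * M) (a (Suc j)) (b (Suc j)) (c * C ^ ((d ^ k - 1) * M) * T)" by blast
    define c1 where "c1 = (\<Sum>i\<le>d - 1. N (a j ^ i * b j ^ (d - 1 - i)))"
    have "powers_bounded (d ^ Suc k * M) (a j) (b j) (c1 * c * C ^ ((d ^ Suc k - 1) * M) * T)"
      if M: "M \<ge> 1" and bd: "powers_bounded M (a (j + Suc k)) (b (j + Suc k)) T" for M T
    proof -
      have "powers_bounded (d ^ k * M) (a (Suc j)) (b (Suc j)) (c * C ^ ((d ^ k - 1) * M) * T)"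
        using c[OF M] bd by simp
      then have "powers_bounded (d * (d ^ k * M)) (a j) (b j)
          (c1 * C ^ (d ^ k * M) * (c * C ^ ((d ^ k - 1) * M) * T))"
        using de M unfolding ab
        by (intro powers_bounded_form_preimage[OF _ \<alpha>\<beta> mem \<kappa>(2) bezout C_def c1_def]) auto
      then have "powers_bounded (d ^ Suc k * M) (a j) (b j)
          (c1 * C ^ (d ^ k * M) * (c * C ^ ((d ^ k - 1) * M) * T))" by (simp add: mult.assoc)
      moreover have "c1 * C ^ (d ^ k * M) * (c * C ^ ((d ^ k - 1) * M) * T) \<le>
          c1 * c * C ^ ((d ^ Suc k - 1) * M) * T"
      proof -
        have "1 \<le> d ^ k" using de by simp
        moreover have "2 * d ^ k \<le> d ^ Suc k" using de by simp
        ultimately have "d ^ k + (d ^ k - 1) \<le> d ^ Suc k - 1" by linarith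
        then have "C ^ (d ^ k * M + (d ^ k - 1) * M) \<le> C ^ ((d ^ Suc k - 1) * M)"
          unfolding distrib_right[symmetric] by (intro power_increasing mult_right_mono) (auto simp: C_def)
        then have "(c1 * c * T) * C ^ (d ^ k * M + (d ^ k - 1) * M) \<le> (c1 * c * T) * C ^ ((d ^ Suc k - 1) * M)"
          by (rule mult_left_mono) simp
        then show ?thesis by (simp only: power_add mult_ac)
      qed
      ultimately show ?thesis by (rule powers_bounded_mono)
    qed
    then show ?case by blast
  qed
  \<comment> \<open>The accumulated exponent 1 + e + ... + e ^ (n - 1) of C' is coarsened to n * e ^
    n, which also covers e = 1.\<close>
  have push: "powers_bounded (m + 1) (u n) (v n) ((K * C' ^ n) ^ (e ^ n * m))" for n m
  proof (induction n arbitrary: m)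
    case 0
    have "u 0 ^ i * v 0 ^ j \<in> R \<and> N (u 0 ^ i * v 0 ^ j) \<le> K ^ (i + j)" for i j
    proof
      show "u 0 ^ i * v 0 ^ j \<in> R" using init by (intro mult_mem power_mem)
      have "N (u 0 ^ i * v 0 ^ j) \<le> N (u 0 ^ i) * N (v 0 ^ j)"
        using init by (intro size_mult power_mem)
      also have "\<dots> \<le> N (u 0) ^ i * N (v 0) ^ j" using init by (intro mult_mono size_power) auto
      also have "\<dots> \<le> K ^ i * K ^ j" by (intro mult_mono power_mono) (auto simp: K_def)
      finally show "N (u 0 ^ i * v 0 ^ j) \<le> K ^ (i + j)" by (simp add: power_add)
    qed
    then show ?case unfolding powers_bounded_def by (intro exI[of _ 1]) auto
  next
    case (Suc n)
    have "powers_bounded (m + 1) (u (Suc n)) (v (Suc n)) (C' ^ m * (K * C' ^ n) ^ (e ^ n * (e * m)))"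
      unfolding uv by (rule powers_bounded_form_image[OF PQ(3,4) C'_def Suc.IH])
    moreover have "C' ^ m * (K * C' ^ n) ^ (e ^ n * (e * m)) \<le> (K * C' ^ Suc n) ^ (e ^ Suc n * m)"
    proof (cases "C' = 0")
      case True
      then show ?thesis by (cases "m = 0") (auto simp: zero_power)
    next
      case False
      have "1 * m \<le> e ^ Suc n * m" using de by (intro mult_right_mono) auto
      then have "C' ^ m \<le> C' ^ (e ^ Suc n * m)" using False by (intro power_increasing) auto
      then have "C' ^ m * (K * C' ^ n) ^ (e ^ n * (e * m)) \<le> C' ^ (e ^ Suc n * m) * (K * C' ^ n) ^ (e ^ n * (e * m))"
        by (rule mult_right_mono) simp
      also have "\<dots> = (K * C' ^ Suc n) ^ (e ^ Suc n * m)"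
        by (simp add: power_mult_distrib[symmetric] mult_ac)
      finally show ?thesis .
    qed
    ultimately show ?case by (rule powers_bounded_mono)
  qed
  \<comment> \<open>C is paid for pulling back and 2 for the coincidence. Unlike D and c below, S
    does not depend on the orbit point j.\<close>
  define S where "S = 2 * C"
  define s where "s = K + C'"
  have sK: "K \<le> 2 ^ s" "C' \<le> 2 ^ s" using less_exp[of s] unfolding s_def by linarith+
  have bounded: "\<exists>D c. D \<ge> 1 \<and> (\<forall>m\<ge>1. powers_bounded (D * m) (a j) (b j) (c * S ^ (D * m)))" for j
  proof -
    obtain n1 where n1: "\<And>n. n \<ge> n1 \<Longrightarrow> s * (n + 1) * e ^ n \<le> d ^ (n - j)"
      using exponential_dominates[OF de(2), of s j] unfolding eventually_sequentially by blast
    \<comment> \<open>The coincidence is chosen after j, so late that d ^ (n - j) dominates the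
      exponent of the bound from \<open>push\<close>.\<close>
    obtain n \<mu> where n: "n > max n1 j" "\<mu> \<noteq> 0" "u n = \<mu> * a n" "v n = \<mu> * b n"
      using coincide unfolding infinite_nat_iff_unbounded by blast
    define k where "k = n - j"
    have jk: "j + k = n" using n by (simp add: k_def)
    have "(K * C' ^ n) ^ (e ^ n) \<le> 2 ^ (s * (n + 1) * e ^ n)" by (rule iterate_bound_le[OF sK])
    also have "\<dots> \<le> 2 ^ (d ^ k)" unfolding k_def using n by (intro power_increasing n1) auto
    finally have B: "(K * C' ^ n) ^ (e ^ n) \<le> 2 ^ (d ^ k)" .
    obtain c where c: "\<And>M T. M \<ge> 1 \<Longrightarrow> powers_bounded M (a n) (b n) T \<Longrightarrow>
      powers_bounded (d ^ k * M) (a j) (b j) (c * C ^ ((d ^ k - 1) * M) * T)"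
      using pull[of j k] unfolding jk by blast
    have "powers_bounded (d ^ k * m) (a j) (b j) (c * S ^ (d ^ k * m))" if m: "m \<ge> 1" for m
    proof -
      have "powers_bounded m (u n) (v n) ((K * C' ^ n) ^ (e ^ n * (m - 1)))"
        using push[of "m - 1" n] m by simp
      then have "powers_bounded m (a n) (b n) ((K * C' ^ n) ^ (e ^ n * (m - 1)))"
        unfolding n(3,4) using n(2) by (rule powers_bounded_scale)
      moreover have "(K * C' ^ n) ^ (e ^ n * (m - 1)) \<le> 2 ^ (d ^ k * m)"
      proof -
        have "((K * C' ^ n) ^ (e ^ n)) ^ (m - 1) \<le> (2 ^ (d ^ k)) ^ (m - 1)" using B by (intro power_mono) auto
        also have "\<dots> \<le> (2 ^ (d ^ k)) ^ m" by (intro power_increasing) auto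
        finally show ?thesis by (simp add: power_mult)
      qed
      ultimately have "powers_bounded m (a n) (b n) (2 ^ (d ^ k * m))" by (rule powers_bounded_mono)
      from c[OF m this]
      have "powers_bounded (d ^ k * m) (a j) (b j) (c * C ^ ((d ^ k - 1) * m) * 2 ^ (d ^ k * m))" .
      moreover have "c * C ^ ((d ^ k - 1) * m) * 2 ^ (d ^ k * m) \<le> c * S ^ (d ^ k * m)"
      proof -
        have "C ^ ((d ^ k - 1) * m) \<le> C ^ (d ^ k * m)"
          by (intro power_increasing mult_right_mono) (auto simp: C_def)
        then have "c * C ^ ((d ^ k - 1) * m) * 2 ^ (d ^ k * m) \<le> c * C ^ (d ^ k * m) * 2 ^ (d ^ k * m)"
          by (intro mult_right_mono mult_left_mono) auto
        then show ?thesis by (simp add: S_def power_mult_distrib mult_ac)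
      qed
      ultimately show ?thesis by (rule powers_bounded_mono)
    qed
    moreover have "d ^ k \<ge> 1" using de by simp
    ultimately show ?thesis by blast
  qed
  \<comment> \<open>Inverting a nonzero starting coordinate makes the first point unimodular modulo
    I; inverting \<kappa> propagates this along the orbit.\<close>
  define z where "z = (if a 0 \<noteq> 0 then a 0 else b 0)"
  have "\<kappa> * z \<in> R" "\<kappa> * z \<noteq> 0" using \<kappa> init by (auto simp: z_def intro: mult_mem)
  from separating[OF this, of "4 * S ^ 4"] obtain I \<sigma> n0 where I: "subring_ideal R I" "finite_index R I"
    and \<sigma>: "\<sigma> \<in> R" "\<kappa> * z * \<sigma> - 1 \<in> I"
    and small: "\<And>n x. n \<ge> n0 \<Longrightarrow> x \<in> ideal_power R I n \<Longrightarrow> N x \<le> (4 * S ^ 4) ^ n \<Longrightarrow> x = 0"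
    by metis
  interpret subring_ideal R I by fact
  have zR: "z \<in> R" using init by (simp add: z_def)
  have unit: "\<exists>\<sigma>\<in>R. \<kappa> * \<sigma> - 1 \<in> I"
    using \<sigma> zR by (intro bexI[of _ "z * \<sigma>"] mult_mem) (simp_all add: mult.assoc)
  have unimod: "\<exists>x\<in>R. \<exists>y\<in>R. 1 - (x * a n + y * b n) \<in> I" for n
  proof (induction n)
    case 0
    have "1 - \<kappa> * \<sigma> * z \<in> I" using ideal_uminus[OF \<sigma>(2)] by (simp add: mult_ac)
    then show ?case
    proof (cases "a 0 = 0")
      case True
      then show ?thesis using \<open>1 - \<kappa> * \<sigma> * z \<in> I\<close> \<kappa> \<sigma>
        by (intro bexI[of _ 0] bexI[of _ "\<kappa> * \<sigma>"] mult_mem zero_mem) (auto simp: z_def)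
    next
      case False
      then show ?thesis using \<open>1 - \<kappa> * \<sigma> * z \<in> I\<close> \<kappa> \<sigma>
        by (intro bexI[of _ "\<kappa> * \<sigma>"] bexI[of _ 0] mult_mem zero_mem) (auto simp: z_def)
    qed
  next
    case (Suc n)
    show ?case unfolding ab
      by (rule unimodular_form_image[OF _ \<alpha>\<beta> mem \<kappa>(1) unit bezout Suc]) (use de in auto)
  qed
  from I(2) obtain F where F: "finite F" "F \<subseteq> R" "\<And>x. x \<in> R \<Longrightarrow> \<exists>y\<in>F. x - y \<in> I"
    unfolding finite_index_def by blast
  then obtain \<rho> where \<rho>: "\<And>x. x \<in> R \<Longrightarrow> \<rho> x \<in> F \<and> x - \<rho> x \<in> I" by metis
  \<comment> \<open>Pigeonhole on residues of coordinate vectors, not of projective points: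
    congruent vectors have their determinant in I.\<close>
  define h where "h n = (\<rho> (a n), \<rho> (b n))" for n
  have "finite (range h)"
    by (rule finite_subset[of _ "F \<times> F"]) (use F(1) \<rho> mem in \<open>auto simp: h_def\<close>)
  then have "\<not> inj h" using finite_imageD by blast
  then obtain j k where jk: "j \<noteq> k" "h j = h k" by (auto simp: inj_def)
  have cong: "x - y \<in> I" if "x \<in> R" "y \<in> R" "\<rho> x = \<rho> y" for x y
    using ideal_diff[of "x - \<rho> x" "y - \<rho> y"] \<rho> that by fastforce
  have "a j - a k \<in> I" "b j - b k \<in> I" using jk(2) mem by (auto simp: h_def intro: cong)
  then have "a k * (- (b j - b k)) + (a j - a k) * b k \<in> I"
    by (intro ideal_add ideal_mult ideal_mult_right ideal_uminus mem)
  then have "a j * b k - a k * b j \<in> I" by (simp add: algebra_simps)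
  moreover obtain D c D' c' where "D \<ge> 1" "\<And>m. m \<ge> 1 \<Longrightarrow> powers_bounded (D * m) (a j) (b j) (c * S ^ (D * m))"
    "D' \<ge> 1" "\<And>m. m \<ge> 1 \<Longrightarrow> powers_bounded (D' * m) (a k) (b k) (c' * S ^ (D' * m))"
    using bounded by meson
  moreover have "S \<ge> 1" by (simp add: S_def C_def)
  ultimately have "a j * b k = a k * b j"
    by (intro congruent_points_eq[OF I(1) mem mem small _ unimod unimod])
  with jk show ?thesis by blast
qed

section \<open>Rational maps\<close>

lemma form_smult: "form d (\<lambda>l. r * c l) x y = r * form d c x y"
  by (simp add: form_def sum_distrib_left mult.assoc)

lemma form_dehomogenize:
  fixes x y :: "'a :: field"
  assumes "degree p \<le> d" "y \<noteq> 0"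
  shows "form d (coeff p) x y = y ^ d * poly p (x / y)"
proof -
  have "poly p (x / y) = (\<Sum>l\<le>d. coeff p l * (x / y) ^ l)"
    unfolding poly_altdef using assms(1) by (intro sum.mono_neutral_left) (auto intro: coeff_eq_0)
  then have "y ^ d * poly p (x / y) = (\<Sum>l\<le>d. y ^ d * (coeff p l * (x / y) ^ l))"
    by (simp add: sum_distrib_left)
  also have "\<dots> = form d (coeff p) x y"
    unfolding form_def using assms(2)
    by (intro sum.cong) (auto simp: power_diff power_divide field_simps)
  finally show ?thesis by simp
qed

lemma form_infinity: "form d c x 0 = c d * x ^ d"
proof -
  have "form d c x 0 = (\<Sum>l\<in>{d}. c l * x ^ l * 0 ^ (d - l))"
    unfolding form_def by (rule sum.mono_neutral_right) (auto simp: power_0_left split: if_splits)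
  then show ?thesis by simp
qed

lemma form_mult:
  fixes x y :: "'a :: field"
  assumes "degree p \<le> m" "degree q \<le> n"
  shows "form m (coeff p) x y * form n (coeff q) x y = form (m + n) (coeff (p * q)) x y"
proof (cases "y = 0")
  case True
  have "coeff (p * q) (m + n) = (\<Sum>i\<in>{m}. coeff p i * coeff q (m + n - i))"
    unfolding coeff_mult
  proof (rule sum.mono_neutral_right)
    show "\<forall>i\<in>{..m + n} - {m}. coeff p i * coeff q (m + n - i) = 0"
    proof
      fix i assume "i \<in> {..m + n} - {m}"
      then have "i > m \<or> m + n - i > n" by auto
      then show "coeff p i * coeff q (m + n - i) = 0" using assms by (auto simp: coeff_eq_0)
    qed
  qed auto
  then show ?thesis using True by (simp add: form_infinity power_add)
next
  case False
  have "degree (p * q) \<le> m + n" using degree_mult_le[of p q] assms by linarith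
  then show ?thesis using assms False by (simp add: form_dehomogenize power_add)
qed

text \<open>If p has degree d, reduce the cofactor B modulo p; the degree of A is then read off from
  A * p = s - B * q. If instead q has degree d, the roles are exchanged.\<close>

lemma bezout_degree_bound:
  fixes p q s :: "'a :: field_gcd poly"
  assumes "coprime p q" and d: "d = max (degree p) (degree q)" "d \<ge> 1" and s: "degree s \<le> 2 * d - 1"
  shows "\<exists>A B. degree A \<le> d - 1 \<and> degree B \<le> d - 1 \<and> s = A * p + B * q"
proof -
  have main: "\<exists>A B. degree A \<le> d - 1 \<and> degree B \<le> d - 1 \<and> s = A * p + B * q"
    if "coprime p q" "degree p = d" "degree q \<le> d" for p q :: "'a poly"
  proof -
    have "gcd p q = 1" using that(1) by (rule coprime_imp_gcd_eq_1)
    then obtain u v where uv: "u * p + v * q = 1"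
      using bezout_coefficients_fst_snd[of p q] by metis
    define A where "A = s * u + ((s * v) div p) * q"
    define B where "B = (s * v) mod p"
    have "p \<noteq> 0" using that(2) d(2) by auto
    have B: "degree B < d" unfolding B_def
      using degree_mod_less[OF \<open>p \<noteq> 0\<close>, of "s * v"] that(2) d(2) by auto
    have "A * p + B * q = s * (u * p) + (s * v div p * p + s * v mod p) * q"
      unfolding A_def B_def by (simp only: algebra_simps)
    also have "\<dots> = s * (u * p + v * q)" unfolding div_mult_mod_eq by (simp only: algebra_simps)
    finally have eq: "A * p + B * q = s" by (simp add: uv)
    have "degree A \<le> d - 1"
    proof (cases "A = 0")
      case False
      have "degree A + d = degree (A * p)" using False \<open>p \<noteq> 0\<close> that(2) by (simp add: degree_mult_eq)
      also have "A * p = s - B * q" by (simp flip: eq)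
      also have "degree (s - B * q) \<le> 2 * d - 1"
      proof (rule degree_diff_le[OF s])
        show "degree (B * q) \<le> 2 * d - 1" using degree_mult_le[of B q] B that(3) by linarith
      qed
      finally show ?thesis by simp
    qed simp
    with B eq show ?thesis by (intro exI[of _ A] exI[of _ B]) auto
  qed
  show ?thesis
  proof (cases "degree q \<le> degree p")
    case True
    then show ?thesis using main[of p q] assms by simp
  next
    case False
    have "coprime q p" using assms(1) by (simp add: coprime_commute)
    then obtain A B where "degree A \<le> d - 1" "degree B \<le> d - 1" "s = A * q + B * p"
      using main[of q p] d False by auto
    then show ?thesis by (intro exI[of _ B] exI[of _ A]) (simp add: add.commute)
  qed
qed

text \<open>The forms of a coprime pair have no common zero on the projective line, so they generate
  all monomials of degree 2 * d - 1; the identities are homogenized from Bezout identities with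
  bounded degrees, without resultants.\<close>

lemma bezout_forms:
  fixes p q :: "'a :: field_gcd poly"
  assumes "coprime p q" "d = max (degree p) (degree q)" "d \<ge> 1"
  shows "\<exists>A B. \<forall>i j x y. i + j = 2 * d - 1 \<longrightarrow>
    x ^ i * y ^ j = form (d - 1) (coeff (A i)) x y * form d (coeff p) x y +
      form (d - 1) (coeff (B i)) x y * form d (coeff q) x y"
proof -
  have "\<forall>i. \<exists>A B. i \<le> 2 * d - 1 \<longrightarrow> degree A \<le> d - 1 \<and> degree B \<le> d - 1 \<and> monom 1 i = A * p + B * q"
    using bezout_degree_bound[OF assms] degree_monom_le order_trans by meson
  then obtain A B where AB: "\<And>i. i \<le> 2 * d - 1 \<Longrightarrow>
      degree (A i) \<le> d - 1 \<and> degree (B i) \<le> d - 1 \<and> monom 1 i = A i * p + B i * q"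
    by metis
  have "x ^ i * y ^ j = form (d - 1) (coeff (A i)) x y * form d (coeff p) x y +
      form (d - 1) (coeff (B i)) x y * form d (coeff q) x y" if ij: "i + j = 2 * d - 1" for i j x y
  proof -
    have *: "degree (A i) \<le> d - 1" "degree (B i) \<le> d - 1" "monom 1 i = A i * p + B i * q"
      using AB[of i] ij by auto
    have "form (d - 1 + d) (coeff (A i * p)) x y + form (d - 1 + d) (coeff (B i * q)) x y =
        form (d - 1 + d) (coeff (monom 1 i)) x y"
      unfolding *(3) form_def by (simp add: distrib_right sum.distrib)
    also have "\<dots> = (\<Sum>l\<in>{i}. coeff (monom 1 i) l * x ^ l * y ^ (d - 1 + d - l))"
      unfolding form_def by (rule sum.mono_neutral_right) (use ij in auto)
    also have "\<dots> = x ^ i * y ^ j" using ij by (auto intro: arg_cong[where f = "power y"])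
    finally show ?thesis
      using *(1,2) assms(2) by (simp add: form_mult)
  qed
  then show ?thesis by blast
qed

section \<open>Homogeneous coordinates on the sphere\<close>

lemma P1_quot_scale: "c \<noteq> 0 \<Longrightarrow> P1_quot (c * a) (c * b) = P1_quot a b"
  by (simp add: P1_quot_def)

lemma P1_quot_cross: "a \<noteq> 0 \<or> b \<noteq> 0 \<Longrightarrow> u \<noteq> 0 \<or> v \<noteq> 0 \<Longrightarrow> P1_quot a b = P1_quot u v \<longleftrightarrow> a * v = u * b"
  by (auto simp: P1_quot_def field_simps split: if_splits)

lemma P1_quot_eq_proportional:
  assumes "a \<noteq> 0 \<or> b \<noteq> 0" "u \<noteq> 0 \<or> v \<noteq> 0" "P1_quot a b = P1_quot u v"
  shows "\<exists>\<mu>. \<mu> \<noteq> 0 \<and> u = \<mu> * a \<and> v = \<mu> * b"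
proof (cases "b = 0")
  case True
  then have "v = 0" using assms(3) by (auto simp: P1_quot_def split: if_splits)
  then show ?thesis using True assms by (intro exI[of _ "u / a"]) auto
next
  case False
  then have "v \<noteq> 0" "a / b = u / v" using assms(3) by (auto simp: P1_quot_def split: if_splits)
  then show ?thesis using False by (intro exI[of _ "v / b"]) (auto simp: field_simps)
qed

lemma P1_quot_surj: "\<exists>a b. (a \<noteq> 0 \<or> b \<noteq> 0) \<and> x = P1_quot a b"
proof (cases x)
  case (Finite z)
  then show ?thesis by (intro exI[of _ z] exI[of _ 1]) (simp add: P1_quot_def)
next
  case Infinity
  then show ?thesis by (intro exI[of _ 1] exI[of _ 0]) (simp add: P1_quot_def)
qed

text \<open>Coprimality rules out a common zero at finite points; at infinity one of the two
  coefficients of index d is a leading coefficient. The common factor r, used later to bring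
  coefficients into a ring, does not move the point.\<close>

lemma ratfun_map_form:
  assumes f: "quot_of_fract f = (p, q)" and d: "d = ratfun_degree f"
    and ab: "a \<noteq> 0 \<or> b \<noteq> 0" and r: "r \<noteq> 0"
  defines "u \<equiv> form d (\<lambda>l. r * coeff p l) a b" and "v \<equiv> form d (\<lambda>l. r * coeff q l) a b"
  shows "(u \<noteq> 0 \<or> v \<noteq> 0) \<and> P1_quot u v = ratfun_map f (P1_quot a b)"
proof -
  have cop: "coprime p q" using coprime_quot_of_fract[of f] f by simp
  have q: "q \<noteq> 0" using snd_quot_of_fract_nonzero[of f] f by simp
  have d': "d = max (degree p) (degree q)" using d f by (simp add: ratfun_degree_def)
  show ?thesis
  proof (cases "b = 0")
    case True
    have "coeff p d \<noteq> 0 \<or> coeff q d \<noteq> 0"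
    proof (cases "degree q = d")
      case True
      then show ?thesis using q by auto
    next
      case False
      then have "degree p = d" "d \<noteq> 0" using d' by (auto simp: max_def split: if_splits)
      then show ?thesis by auto
    qed
    then show ?thesis using True ab r d f
      by (auto simp: u_def v_def form_smult form_infinity ratfun_map_def P1_quot_def)
  next
    case False
    have u: "u = (r * b ^ d) * poly p (a / b)" and v: "v = (r * b ^ d) * poly q (a / b)"
      unfolding u_def v_def form_smult using False d' by (simp_all add: form_dehomogenize)
    have "poly p (a / b) \<noteq> 0 \<or> poly q (a / b) \<noteq> 0"
      using coprime_poly_0[OF cop] by blast
    moreover have "P1_quot a b = Finite (a / b)" using False by (simp add: P1_quot_def)
    moreover have "r * b ^ d \<noteq> 0" using r False by simp
    ultimately show ?thesis unfolding u v P1_quot_scale[OF \<open>r * b ^ d \<noteq> 0\<close>]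
      using r False f by (auto simp: ratfun_map_def)
  qed
qed

section \<open>Finite orbits and the comparison of degrees\<close>

lemma finite_orbit:
  fixes f :: "'a \<Rightarrow> 'a"
  assumes "(f ^^ j) x = (f ^^ k) x" "j < k"
  shows "finite (range (\<lambda>n. (f ^^ n) x))"
proof -
  have "(f ^^ n) x \<in> (\<lambda>n. (f ^^ n) x) ` {..<k}" for n
  proof (induction n rule: less_induct)
    case (less n)
    show ?case
    proof (cases "n < k")
      case False
      then have "(f ^^ n) x = (f ^^ (n - k)) ((f ^^ k) x)"
        by (metis add_diff_inverse_nat add.commute comp_apply funpow_add)
      also have "\<dots> = (f ^^ (n - k + j)) x" by (simp add: funpow_add flip: assms(1))
      finally show ?thesis using less[of "n - k + j"] False assms(2) by auto
    qed auto
  qed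
  then have "range (\<lambda>n. (f ^^ n) x) \<subseteq> (\<lambda>n. (f ^^ n) x) ` {..<k}" by blast
  then show ?thesis using finite_surj by blast
qed

lemma finite_range_coeff: "finite (range (coeff p))"
proof -
  have "coeff p i \<in> insert 0 (coeff p ` {..degree p})" for i
    by (cases "i \<le> degree p") (auto simp: coeff_eq_0)
  then have "range (coeff p) \<subseteq> insert 0 (coeff p ` {..degree p})" by blast
  then show ?thesis by (rule finite_subset) simp
qed

lemma ratfun_map_const:
  assumes "ratfun_degree g = 0"
  shows "ratfun_map g x = ratfun_map g y"
proof -
  obtain p q where pq: "quot_of_fract g = (p, q)" by fastforce
  then have "degree p = 0" "degree q = 0" using assms by (auto simp: ratfun_degree_def)
  then obtain s t where "p = [:s:]" "q = [:t:]" by (auto elim!: degree_eq_zeroE)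
  then show ?thesis using pq assms by (auto simp: ratfun_map_def split: P1.splits)
qed

text \<open>The disjunction reflects two endings: a constant g has a finite orbit itself, while for
  \<open>ratfun_degree g\<close> at least 1 the orbit of x0 under f is shown to be finite.\<close>

lemma orbit_coincidences_finite_orbit:
  assumes "ratfun_degree g < ratfun_degree f"
    and coincide: "infinite {n. (ratfun_map f ^^ n) x0 = (ratfun_map g ^^ n) y0}"
  shows "\<exists>h z. (h, z) \<in> {(f, x0), (g, y0)} \<and> finite (range (\<lambda>n. (ratfun_map h ^^ n) z))"
proof (cases "ratfun_degree g = 0")
  case True
  have "(ratfun_map g ^^ 1) y0 = (ratfun_map g ^^ 2) y0"
    using ratfun_map_const[OF True] by (simp add: numeral_2_eq_2)
  then show ?thesis using finite_orbit[of 1 "ratfun_map g" y0 2] by auto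
next
  case False
  define d where "d = ratfun_degree f"
  define e where "e = ratfun_degree g"
  have de: "1 \<le> e" "e < d" using assms False by (auto simp: d_def e_def)
  obtain p q where pq: "quot_of_fract f = (p, q)" by fastforce
  obtain p' q' where pq': "quot_of_fract g = (p', q')" by fastforce
  have cop: "coprime p q" using coprime_quot_of_fract[of f] pq by simp
  have d': "d = max (degree p) (degree q)" using pq by (simp add: ratfun_degree_def d_def)
  obtain A B where AB: "\<And>i j x y. i + j = 2 * d - 1 \<Longrightarrow>
    x ^ i * y ^ j = form (d - 1) (coeff (A i)) x y * form d (coeff p) x y +
      form (d - 1) (coeff (B i)) x y * form d (coeff q) x y"
    using bezout_forms[OF cop d'] de by auto
  obtain a0 b0 where ab0: "a0 \<noteq> 0 \<or> b0 \<noteq> 0" "x0 = P1_quot a0 b0" using P1_quot_surj by blast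
  obtain u0 v0 where uv0: "u0 \<noteq> 0 \<or> v0 \<noteq> 0" "y0 = P1_quot u0 v0" using P1_quot_surj by blast
  \<comment> \<open>All complex numbers entering the forms, the starting points and the Bezout
    identities; they are finitely many, so one ring and one denominator r serve.\<close>
  define X where "X = {a0, b0, u0, v0} \<union> range (coeff p) \<union> range (coeff q) \<union> range (coeff p') \<union>
    range (coeff q') \<union> (\<Union>i\<le>2 * d - 1. range (coeff (A i)) \<union> range (coeff (B i)))"
  have "finite X" unfolding X_def by (auto intro: finite_range_coeff)
  then obtain R N r where R: "separated_ring R N" "r \<in> R" "r \<noteq> 0" and r: "\<And>c. c \<in> X \<Longrightarrow> r * c \<in> R"
    using separated_ring_exists by metis
  interpret separated_ring R N by fact
  define ab where "ab = rec_nat (r * a0, r * b0)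
    (\<lambda>_ (a, b). (form d (\<lambda>l. r * coeff p l) a b, form d (\<lambda>l. r * coeff q l) a b))"
  define uv where "uv = rec_nat (r * u0, r * v0)
    (\<lambda>_ (u, v). (form e (\<lambda>l. r * coeff p' l) u v, form e (\<lambda>l. r * coeff q' l) u v))"
  have ab: "(fst (ab n) \<noteq> 0 \<or> snd (ab n) \<noteq> 0) \<and> P1_quot (fst (ab n)) (snd (ab n)) = (ratfun_map f ^^ n) x0" for n
  proof (induction n)
    case 0
    show ?case using ab0 R(3) by (simp add: ab_def P1_quot_scale)
  next
    case (Suc n)
    then show ?case using ratfun_map_form[OF pq d_def _ R(3), of "fst (ab n)" "snd (ab n)"]
      by (simp add: ab_def case_prod_beta)
  qed
  have uv: "(fst (uv n) \<noteq> 0 \<or> snd (uv n) \<noteq> 0) \<and> P1_quot (fst (uv n)) (snd (uv n)) = (ratfun_map g ^^ n) y0" for n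
  proof (induction n)
    case 0
    show ?case using uv0 R(3) by (simp add: uv_def P1_quot_scale)
  next
    case (Suc n)
    then show ?case using ratfun_map_form[OF pq' e_def _ R(3), of "fst (uv n)" "snd (uv n)"]
      by (simp add: uv_def case_prod_beta)
  qed
  \<comment> \<open>\<open>A i\<close> is arbitrary beyond 2 * d - 1 and need not have coefficients
    in X there, hence the default 0.\<close>
  define \<alpha> where "\<alpha> i l = (if i \<le> 2 * d - 1 then r * coeff (A i) l else 0)" for i l
  define \<beta> where "\<beta> i l = (if i \<le> 2 * d - 1 then r * coeff (B i) l else 0)" for i l
  have "\<exists>j k. j \<noteq> k \<and> fst (ab j) * snd (ab k) = fst (ab k) * snd (ab j)"
  proof (rule orbit_coincidences[OF de])
    show "r * coeff p l \<in> R" "r * coeff q l \<in> R" "r * coeff p' l \<in> R" "r * coeff q' l \<in> R" for l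
      by (auto intro!: r simp: X_def)
    \<comment> \<open>The Bezout constant: one factor r clears the cofactors, the other clears p and
      q.\<close>
    show "r * r \<in> R" "r * r \<noteq> 0" using R by (auto intro: mult_mem)
    have "coeff (A i) l \<in> X" "coeff (B i) l \<in> X" if "i \<le> 2 * d - 1" for i l
      unfolding X_def using that by blast+
    then show "\<alpha> i l \<in> R" "\<beta> i l \<in> R" for i l
      unfolding \<alpha>_def \<beta>_def using r zero_mem by auto
    show "r * r * x ^ i * y ^ j = form (d - 1) (\<alpha> i) x y * form d (\<lambda>l. r * coeff p l) x y +
        form (d - 1) (\<beta> i) x y * form d (\<lambda>l. r * coeff q l) x y" if "i + j = 2 * d - 1" for i j x y
    proof -
      have "i \<le> 2 * d - 1" using that by simp
      then have *: "\<alpha> i = (\<lambda>l. r * coeff (A i) l)" "\<beta> i = (\<lambda>l. r * coeff (B i) l)"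
        by (auto simp: \<alpha>_def \<beta>_def fun_eq_iff)
      have "r * r * x ^ i * y ^ j = r * r * (x ^ i * y ^ j)" by simp
      then show ?thesis unfolding * form_smult AB[OF that] by (simp only: algebra_simps)
    qed
    show "infinite {n. \<exists>\<mu>. \<mu> \<noteq> 0 \<and> fst (uv n) = \<mu> * fst (ab n) \<and> snd (uv n) = \<mu> * snd (ab n)}"
    proof (rule infinite_super[OF _ coincide], rule subsetI)
      fix n assume "n \<in> {n. (ratfun_map f ^^ n) x0 = (ratfun_map g ^^ n) y0}"
      then show "n \<in> {n. \<exists>\<mu>. \<mu> \<noteq> 0 \<and> fst (uv n) = \<mu> * fst (ab n) \<and> snd (uv n) = \<mu> * snd (ab n)}"
        using P1_quot_eq_proportional[of "fst (ab n)" "snd (ab n)" "fst (uv n)" "snd (uv n)"] ab[of n] uv[of n]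
        by simp
    qed
    show "fst (ab 0) \<noteq> 0 \<or> snd (ab 0) \<noteq> 0" using ab by blast
  qed (auto simp: ab_def uv_def case_prod_beta X_def intro!: r)
  then obtain j k where jk: "j \<noteq> k" "fst (ab j) * snd (ab k) = fst (ab k) * snd (ab j)" by blast
  then have "(ratfun_map f ^^ j) x0 = (ratfun_map f ^^ k) x0"
    using P1_quot_cross ab by metis
  then have "finite (range (\<lambda>n. (ratfun_map f ^^ n) x0))"
    using finite_orbit[of j "ratfun_map f" x0 k] finite_orbit[of k "ratfun_map f" x0 j] jk(1)
    by (cases j k rule: linorder_cases) auto
  then show ?thesis by blast
qed

theorem theorem7p2:
  fixes f g :: "complex poly fract" and x0 y0 :: P1
  assumes "infinite ({((ratfun_map f ^^ n) x0, (ratfun_map g ^^ n) y0) | n :: nat. True}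
                       \<inter> {(x, x) | x :: P1. True})"
  shows "ratfun_degree f = ratfun_degree g"
proof -
  define X where "X = {n. (ratfun_map f ^^ n) x0 = (ratfun_map g ^^ n) y0}"
  have eq: "{((ratfun_map f ^^ n) x0, (ratfun_map g ^^ n) y0) | n :: nat. True} \<inter> {(x, x) | x :: P1. True} =
      (\<lambda>n. ((ratfun_map f ^^ n) x0, (ratfun_map f ^^ n) x0)) ` X"
    "{((ratfun_map f ^^ n) x0, (ratfun_map g ^^ n) y0) | n :: nat. True} \<inter> {(x, x) | x :: P1. True} =
      (\<lambda>n. ((ratfun_map g ^^ n) y0, (ratfun_map g ^^ n) y0)) ` X"
    by (auto simp: X_def image_iff) metis+
  have X: "infinite X" using assms unfolding eq(1) by blast
  \<comment> \<open>The hypothesis counts points, not indices: infinitely many distinct diagonal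
    points force both orbits to be infinite, against \<open>orbit_coincidences_finite_orbit\<close>
    if the degrees differ.\<close>
  have "infinite ((\<lambda>x. (x, x)) ` (\<lambda>n. (ratfun_map f ^^ n) x0) ` X)"
    "infinite ((\<lambda>x. (x, x)) ` (\<lambda>n. (ratfun_map g ^^ n) y0) ` X)"
    using assms unfolding eq(1) using assms unfolding eq(2) by (simp_all add: image_image)
  then have orbits: "infinite (range (\<lambda>n. (ratfun_map f ^^ n) x0))"
    "infinite (range (\<lambda>n. (ratfun_map g ^^ n) y0))"
    by (meson finite_imageI finite_subset image_mono subset_UNIV)+
  have "infinite {n. (ratfun_map g ^^ n) y0 = (ratfun_map f ^^ n) x0}"
    using X unfolding X_def by (simp add: eq_commute)
  then have "\<not> ratfun_degree g < ratfun_degree f" "\<not> ratfun_degree f < ratfun_degree g"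
    using X orbits orbit_coincidences_finite_orbit[of g f x0 y0] orbit_coincidences_finite_orbit[of f g y0 x0]
    unfolding X_def by auto
  then show ?thesis by simp
qed

end
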